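(* Let $f:\mathbb{R}\to\mathbb{R}$, let $A^1,\dots,A^s\in\mathbb{R}^{n\times d}$ be held by servers $1,\dots,s$, and let $A\in\mathbb{R}^{n\times d}$, $A\neq 0$, be the global matrix $A_{i,j}=f\left(\sum_{t=1}^s A^t_{i,j}\right)$. Let $k\in\{1,\dots,d\}$ and $\varepsilon>0$. Consider the distributed sampling protocol described in the context, with sampler constant $c\in(0,1]$ and parameters $r=\Theta(k^2/\varepsilon^2)$ and $\gamma=O(\sqrt{1/r})$. Then, with constant probability, the protocol outputs a rank-$k$ projection matrix $P$ such that $$\|A-AP\|_F^2\le \|A-[A]_k\|_F^2+O(\varepsilon)\|A\|_F^2 .$$ Moreover, if sampling the rows and reporting the approximate probabilities $\hat Q_{i_1},\dots,\hat Q_{i_r}$ uses $\mathcal{C}$ words of communication, then the whole protocol uses $O(sk^2d/\varepsilon^2+\mathcal{C})$ words of communication. Precisely: for every $c\in(0,1]$ there are constants $C_1,C_2,C_3,p_0>0$, depending only on $c$, such that for all positive integers $n,d,s$, all functions $f:\mathbb{R}\to\mathbb{R}$, all matrices $A^1,\dots,A^s\in\mathbb{R}^{n\times d}$ whose global matrix $A$ with entries $A_{i,j}=f\left(\sum_{t=1}^s A^t_{i,j}\right)$ is nonzero, all $k\in\{1,\dots,d\}$, all $\varepsilon>0$, all integers $r\ge 1$ with $C_1k^2/\varepsilon^2\le r\le 2C_1k^2/\varepsilon^2$, all $0\le\gamma\le C_2/\sqrt r$, and every sampler with constant $c$ and accuracy $\gamma$ as described in the context, with probability at least $p_0$ the output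 satisfies $\|A-AP\|_F^2\le \|A-[A]_k\|_F^2+C_3\varepsilon\|A\|_F^2$, and the communication is at most $C_3\, s k^2 d/\varepsilon^2+\mathcal{C}$ words.
   Context: Model (generalized partition model): there are $s$ servers; server $t$ holds $A^t\in\mathbb{R}^{n\times d}$; the function $f$ is known to all servers. Each server can communicate with server $1$. Communication is counted in words; one word holds one matrix entry (or one row index). Notation: $A_i$ is the $i$-th row of $A$, $|\cdot|_2$ the Euclidean norm, $\|\cdot\|_F$ the Frobenius norm, $[A]_k$ a best rank-$k$ approximation of $A$ in Frobenius norm (given by the truncated SVD). A projection matrix is a $d\times d$ orthogonal projection. Sampler: a distributed procedure that outputs row $i\in\{1,\dots,n\}$ with probability $Q_i$, where $Q_i\ge c\,|A_i|_2^2/\|A\|_F^2$ for all $i$ and $\sum_i Q_i=1$, and which for a sampled row $i$ reports a number $\hat Q_i$ with $(1-\gamma)Q_i\le \hat Q_i\le(1+\gamma)Q_i$. Protocol: (1) run the sampler $r$ times independently, obtaining row indices $i_1,\dots,i_r$ and the numbers $\hat Q_{i_1},\dots,\hat Q_{i_r}$; (2) for each $i'\in\{1,\dots,r\}$ every server $t$ sends the row $A^t_{i_{i'}}$ to server $1$, which computes $A_{i_{i'}}$ by summing and applying $f$ entrywise, and forms $B\in\mathbb{R}^{r\times d}$ with rows $B_{i'}=A_{i_{i'}}/\sqrt{r\hat Q_{i_{i'}}}$; (3) server $1$ computes the top $k$ right singular vectors $V_{:,1},\dots,V_{:,k}$ of $B$ (orthonormal) and outputs $P=VV^T$. *)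

theory Defs
  imports "HOL-Probability.Probability" "Jordan_Normal_Form.DL_Rank"
begin

no_notation vec_nth (infixl "$" 90)

definition vec_norm2 :: "real vec \<Rightarrow> real" where
  "vec_norm2 v = sqrt (\<Sum>j<dim_vec v. (v $ j)\<^sup>2)"

definition frobenius_norm :: "real mat \<Rightarrow> real" where
  "frobenius_norm A = sqrt (\<Sum>i<dim_row A. \<Sum>j<dim_col A. (A $$ (i, j))\<^sup>2)"

definition mat_rank :: "real mat \<Rightarrow> nat" where
  "mat_rank A = vec_space.rank (dim_row A) A"

definition orthogonal_matrix :: "nat \<Rightarrow> real mat \<Rightarrow> bool" where
  "orthogonal_matrix m U \<longleftrightarrow> U \<in> carrier_mat m m \<and> transpose_mat U * U = 1\<^sub>m m"

text \<open>Full singular value decomposition \<open>B = U \<Sigma> V\<^sup>T\<close>: both orthogonal factors are square, so that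
  \<open>V\<close> has \<open>dim_col B\<close> columns, also when \<open>B\<close> has fewer rows than columns.\<close>

definition is_svd :: "real mat \<Rightarrow> real mat \<Rightarrow> (nat \<Rightarrow> real) \<Rightarrow> real mat \<Rightarrow> bool" where
  "is_svd B U \<sigma> V \<longleftrightarrow>
     orthogonal_matrix (dim_row B) U \<and> orthogonal_matrix (dim_col B) V \<and>
     (\<forall>i<min (dim_row B) (dim_col B). 0 \<le> \<sigma> i) \<and>
     (\<forall>i j. i \<le> j \<and> j < min (dim_row B) (dim_col B) \<longrightarrow> \<sigma> j \<le> \<sigma> i) \<and>
     B = U * mat (dim_row B) (dim_col B) (\<lambda>(i, j). if i = j then \<sigma> i else 0) * transpose_mat V"

text \<open>The columns of \<open>W\<close> are top \<open>k\<close> right singular vectors of \<open>B\<close>; they are not unique.\<close>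

definition top_right_singular_vectors :: "nat \<Rightarrow> real mat \<Rightarrow> real mat \<Rightarrow> bool" where
  "top_right_singular_vectors k B W \<longleftrightarrow>
     (\<exists>U \<sigma> V. is_svd B U \<sigma> V \<and> W = mat (dim_col B) k (\<lambda>(i, j). V $$ (i, j)))"

definition best_rank_approx :: "nat \<Rightarrow> real mat \<Rightarrow> real mat \<Rightarrow> bool" where
  "best_rank_approx k A M \<longleftrightarrow>
     M \<in> carrier_mat (dim_row A) (dim_col A) \<and> mat_rank M \<le> k \<and>
     (\<forall>N \<in> carrier_mat (dim_row A) (dim_col A). mat_rank N \<le> k \<longrightarrow>
        frobenius_norm (A - M) \<le> frobenius_norm (A - N))"

definition projection_matrix :: "nat \<Rightarrow> real mat \<Rightarrow> bool" where
  "projection_matrix d P \<longleftrightarrow> P \<in> carrier_mat d d \<and> P * P = P \<and> transpose_mat P = P"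

text \<open>Servers are numbered \<open>1, \<dots>, s\<close>, and server \<open>t\<close> holds \<open>As t\<close>. Rows and columns are numbered
  from \<open>0\<close>.\<close>

definition global_matrix ::
  "(real \<Rightarrow> real) \<Rightarrow> nat \<Rightarrow> (nat \<Rightarrow> real mat) \<Rightarrow> nat \<Rightarrow> nat \<Rightarrow> real mat" where
  "global_matrix f s As n d = mat n d (\<lambda>(i, j). f (\<Sum>t\<in>{1..s}. As t $$ (i, j)))"

datatype word = Scalar real | Index nat

datatype message = Message (sender: nat) (receiver: nat) (payload: "word list")

definition admissible_message :: "nat \<Rightarrow> message \<Rightarrow> bool" where
  "admissible_message s m \<longleftrightarrow>
     sender m \<in> {1..s} \<and> receiver m \<in> {1..s} \<and> (sender m = 1 \<or> receiver m = 1)"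

definition words :: "message list \<Rightarrow> nat" where
  "words ms = (\<Sum>m\<leftarrow>ms. length (payload m))"

text \<open>A sampler enters through the joint distribution \<open>D\<close> of the row index and the reported number
  in one run. The reported number may be random; it need not be a function of the row.\<close>

definition row_prob :: "(nat \<times> real) measure \<Rightarrow> nat \<Rightarrow> real" where
  "row_prob D i = measure D ({i} \<times> UNIV)"

definition sampler :: "real \<Rightarrow> real \<Rightarrow> real mat \<Rightarrow> (nat \<times> real) measure \<Rightarrow> bool" where
  "sampler c \<gamma> A D \<longleftrightarrow>
     prob_space D \<and> sets D = sets (count_space UNIV \<Otimes>\<^sub>M borel) \<and>
     (\<forall>i<dim_row A. row_prob D i \<ge> c * (vec_norm2 (row A i))\<^sup>2 / (frobenius_norm A)\<^sup>2) \<and>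
     (\<Sum>i<dim_row A. row_prob D i) = 1 \<and>
     (AE (i, q) in D. (1 - \<gamma>) * row_prob D i \<le> q \<and> q \<le> (1 + \<gamma>) * row_prob D i)"

text \<open>Outcome of the whole sampling phase: the results of the runs \<open>j = 0, 1, \<dots>\<close>, and all messages
  exchanged in this phase.\<close>

datatype outcome =
  Outcome (run_index: "nat \<Rightarrow> nat") (run_estimate: "nat \<Rightarrow> real") (sampling_messages: "message list")

text \<open>\<open>M\<close> is the distribution of a phase of \<open>r\<close> independent runs. The messages may depend on the runs
  in any way, and may be shared between runs.\<close>

definition sampling_phase ::
  "nat \<Rightarrow> nat \<Rightarrow> (nat \<times> real) measure \<Rightarrow> outcome measure \<Rightarrow> bool" where
  "sampling_phase s r D M \<longleftrightarrow>
     prob_space M \<and>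
     prob_space.indep_vars M (\<lambda>_. count_space UNIV \<Otimes>\<^sub>M borel)
       (\<lambda>j \<omega>. (run_index \<omega> j, run_estimate \<omega> j)) {..<r} \<and>
     (\<forall>j<r. distr M (count_space UNIV \<Otimes>\<^sub>M borel) (\<lambda>\<omega>. (run_index \<omega> j, run_estimate \<omega> j)) = D) \<and>
     (\<forall>\<omega>\<in>space M. \<forall>m\<in>set (sampling_messages \<omega>). admissible_message s m)"

definition aggregated_row ::
  "(real \<Rightarrow> real) \<Rightarrow> nat \<Rightarrow> (nat \<Rightarrow> real mat) \<Rightarrow> nat \<Rightarrow> nat \<Rightarrow> real vec" where
  "aggregated_row f s As d i = vec d (\<lambda>l. f (\<Sum>t\<in>{1..s}. row (As t) i $ l))"

definition sampled_matrix ::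
  "(real \<Rightarrow> real) \<Rightarrow> nat \<Rightarrow> (nat \<Rightarrow> real mat) \<Rightarrow> nat \<Rightarrow> nat \<Rightarrow> outcome \<Rightarrow> real mat" where
  "sampled_matrix f s As d r \<omega> =
     mat r d (\<lambda>(j, l).
       aggregated_row f s As d (run_index \<omega> j) $ l / sqrt (real r * run_estimate \<omega> j))"

definition protocol_output ::
  "(real \<Rightarrow> real) \<Rightarrow> nat \<Rightarrow> (nat \<Rightarrow> real mat) \<Rightarrow> nat \<Rightarrow> nat \<Rightarrow> nat \<Rightarrow> outcome \<Rightarrow> real mat \<Rightarrow> bool" where
  "protocol_output f s As d k r \<omega> P \<longleftrightarrow>
     (\<exists>W. top_right_singular_vectors k (sampled_matrix f s As d r \<omega>) W \<and> P = W * transpose_mat W)"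

text \<open>For every sampled row, server \<open>1\<close> tells each server the row index, and each server replies with
  its row. Server \<open>1\<close> is charged for its own row as well.\<close>

definition row_messages :: "nat \<Rightarrow> (nat \<Rightarrow> real mat) \<Rightarrow> nat \<Rightarrow> outcome \<Rightarrow> message list" where
  "row_messages s As r \<omega> =
     concat (map (\<lambda>j. concat (map (\<lambda>t.
       [Message 1 t [Index (run_index \<omega> j)],
        Message t 1 (map Scalar (list_of_vec (row (As t) (run_index \<omega> j))))])
       [1..<Suc s])) [0..<r])"

definition protocol_messages :: "nat \<Rightarrow> (nat \<Rightarrow> real mat) \<Rightarrow> nat \<Rightarrow> outcome \<Rightarrow> message list" where
  "protocol_messages s As r \<omega> = sampling_messages \<omega> @ row_messages s As r \<omega>"

end

theory Submission
  imports Defs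
begin

text \<open>
  For orthonormal columns \<open>W\<close> one has \<open>\<parallel>A - A W W\<^sup>T\<parallel>\<^sup>2 = \<parallel>A\<parallel>\<^sup>2 - \<parallel>A W\<parallel>\<^sup>2\<close> in Frobenius norm, and a matrix of
  rank at most \<open>k\<close> approximates \<open>A\<close> no better than some orthogonal projection onto \<open>k\<close> dimensions. The top
  right singular vectors of \<open>B\<close> maximize \<open>\<parallel>B W\<parallel>\<^sup>2\<close>, and passing from \<open>B\<close> to \<open>A\<close> changes \<open>\<parallel>A W\<parallel>\<^sup>2\<close> by at
  most \<open>k \<parallel>A\<^sup>T A - B\<^sup>T B\<parallel>\<close>. With the exact row probabilities, \<open>B\<^sup>T B\<close> is an average of \<open>r\<close> independent unbiased
  estimators of \<open>A\<^sup>T A\<close>, each of second moment at most \<open>\<parallel>A\<parallel>\<^sup>4 / c\<close>, so Markov's inequality bounds the squared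
  distance of the Gram matrices by \<open>2 \<parallel>A\<parallel>\<^sup>4 / (c r)\<close> with probability at least \<open>1/2\<close>. The relative error
  \<open>\<gamma> = O(1 / \<surd>r)\<close> of the reported probabilities costs another \<open>O(\<parallel>A\<parallel>\<^sup>4 / (c\<^sup>2 r))\<close>, and \<open>r \<ge> k\<^sup>2 / \<epsilon>\<^sup>2\<close> turns
  both into an error \<open>O(\<epsilon>) \<parallel>A\<parallel>\<^sup>2\<close>.
\<close>

subsection \<open>Existence of singular value decompositions\<close>

text \<open>The unit sphere of n-dimensional space, encoded by functions on all of
  \<open>nat\<close> with zero tail. The function type then carries the product topology, and the
  tail condition keeps the set compact there.\<close>

definition unit_fun :: "nat \<Rightarrow> (nat \<Rightarrow> real) set" where
  "unit_fun n = {x. (\<Sum>i<n. (x i)\<^sup>2) = 1 \<and> (\<forall>i\<ge>n. x i = 0)}"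

lemma unit_fun_abs_le:
  assumes "x \<in> unit_fun n"
  shows "\<bar>x i\<bar> \<le> 1"
proof (cases "i < n")
  case True
  have "(x i)\<^sup>2 \<le> (\<Sum>i<n. (x i)\<^sup>2)"
    using True by (intro member_le_sum) auto
  then have "(x i)\<^sup>2 \<le> 1" using assms by (simp add: unit_fun_def)
  then show ?thesis by (simp add: abs_square_le_1)
qed (use assms in \<open>simp add: unit_fun_def\<close>)

text \<open>By Tychonoff the functions with values in [-1, 1] form a compact cube, and the sphere is
  cut out of it by equations in continuous coordinates.\<close>

lemma compact_unit_fun: "compact (unit_fun n)"
proof -
  have "compactin (product_topology (\<lambda>_. euclidean) UNIV) (PiE (UNIV::nat set) (\<lambda>_. {-1..1::real}))"
    unfolding compactin_PiE by (auto simp: compactin_euclidean_iff)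
  then have cube: "compact (PiE (UNIV::nat set) (\<lambda>_. {-1..1::real}))"
    by (simp add: euclidean_product_topology compactin_euclidean_iff)
  have "closed {x::nat \<Rightarrow> real. (\<Sum>i<n. (x i)\<^sup>2) = 1}"
    by (intro closed_Collect_eq continuous_intros continuous_on_product_coordinates)
  moreover have "closed {x::nat \<Rightarrow> real. \<forall>i\<ge>n. x i = 0}"
    by (intro closed_Collect_all closed_Collect_imp closed_Collect_eq continuous_intros continuous_on_product_coordinates) auto
  ultimately have "closed ({x::nat \<Rightarrow> real. (\<Sum>i<n. (x i)\<^sup>2) = 1} \<inter> {x. \<forall>i\<ge>n. x i = 0})"
    by (rule closed_Int)
  from compact_Int_closed[OF cube this] show ?thesis
    by (rule back_subst[of compact])
      (use unit_fun_abs_le in \<open>fastforce simp: unit_fun_def PiE_def abs_le_iff\<close>)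
qed

lemma unit_fun_nonempty:
  assumes "0 < n"
  shows "(\<lambda>i. if i = 0 then 1 else 0) \<in> unit_fun n"
  using assms by (auto simp: unit_fun_def if_distrib[of "\<lambda>x. x\<^sup>2"] sum.delta cong: if_cong)

text \<open>Equality case of Cauchy-Schwarz. Testing the bound with \<open>w\<close> normalized
  gives |w| <= \<open>\<sigma>\<close>, and then |w - \<sigma> u|^2 = |w|^2 - \<sigma>^2 cannot be
  positive.\<close>

lemma unit_maximizer_proportional:
  fixes w u :: "nat \<Rightarrow> real"
  assumes u: "u \<in> unit_fun n" and max: "\<And>x. x \<in> unit_fun n \<Longrightarrow> (\<Sum>i<n. x i * w i) \<le> \<sigma>"
    and eq: "(\<Sum>i<n. u i * w i) = \<sigma>" and "0 \<le> \<sigma>" "i < n"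
  shows "w i = \<sigma> * u i"
proof -
  define s where "s = sqrt (\<Sum>i<n. (w i)\<^sup>2)"
  have s2: "s\<^sup>2 = (\<Sum>i<n. (w i)\<^sup>2)" by (simp add: s_def sum_nonneg)
  have "s \<ge> 0" by (simp add: s_def sum_nonneg)
  have "s \<le> \<sigma>"
  proof (cases "s = 0")
    case False
    define x where "x i = (if i < n then w i / s else 0)" for i
    have "(\<Sum>i<n. (x i)\<^sup>2) = (\<Sum>i<n. (w i)\<^sup>2) / s\<^sup>2"
      by (simp add: x_def power_divide sum_divide_distrib)
    then have "x \<in> unit_fun n" using False by (simp add: unit_fun_def s2[symmetric]) (simp add: x_def)
    from max[OF this] have "(\<Sum>i<n. x i * w i) \<le> \<sigma>" .
    also have "(\<Sum>i<n. x i * w i) = (\<Sum>i<n. (w i)\<^sup>2) / s"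
      by (simp add: x_def sum_divide_distrib power2_eq_square)
    also have "\<dots> = s" using False by (simp only: s2[symmetric]) (simp add: power2_eq_square)
    finally show ?thesis .
  qed (use \<open>0 \<le> \<sigma>\<close> in simp)
  have "(\<Sum>i<n. (w i - \<sigma> * u i)\<^sup>2)
      = (\<Sum>i<n. (w i)\<^sup>2 - 2 * \<sigma> * (u i * w i) + \<sigma>\<^sup>2 * (u i)\<^sup>2)"
    by (intro sum.cong) (auto simp: power2_eq_square algebra_simps)
  also have "\<dots> = s\<^sup>2 - 2 * \<sigma> * \<sigma> + \<sigma>\<^sup>2"
    using u by (simp add: sum.distrib sum_subtractf sum_distrib_left[symmetric] eq s2 unit_fun_def)
  also have "\<dots> \<le> 0"
    using power_mono[OF \<open>s \<le> \<sigma>\<close> \<open>0 \<le> s\<close>, of 2] by (simp add: power2_eq_square)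
  finally have "(\<Sum>i<n. (w i - \<sigma> * u i)\<^sup>2) = 0"
    using sum_nonneg[of "{..<n}" "\<lambda>i. (w i - \<sigma> * u i)\<^sup>2"] by simp
  then have "(w i - \<sigma> * u i)\<^sup>2 = 0"
    using \<open>i < n\<close> by (subst (asm) sum_nonneg_eq_0_iff) auto
  then show ?thesis by simp
qed

text \<open>A maximizing pair of the bilinear form \<open>x\<^sup>T B y\<close> over two unit spheres is a pair of singular
  vectors, so compactness replaces any eigenvalue theory.\<close>

lemma top_singular_pair:
  fixes B :: "nat \<Rightarrow> nat \<Rightarrow> real"
  assumes "0 < p" "0 < q"
  obtains u v \<sigma> where "u \<in> unit_fun p" "v \<in> unit_fun q" "0 \<le> \<sigma>"
    "\<And>i. i < p \<Longrightarrow> (\<Sum>j<q. B i j * v j) = \<sigma> * u i"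
    "\<And>j. j < q \<Longrightarrow> (\<Sum>i<p. B i j * u i) = \<sigma> * v j"
    "\<And>x y. x \<in> unit_fun p \<Longrightarrow> y \<in> unit_fun q \<Longrightarrow> (\<Sum>i<p. \<Sum>j<q. x i * B i j * y j) \<le> \<sigma>"
proof -
  define g where "g z = (\<Sum>i<p. \<Sum>j<q. fst z i * B i j * snd z j)" for z :: "(nat \<Rightarrow> real) \<times> (nat \<Rightarrow> real)"
  have "continuous_on S (\<lambda>z. fst z i)" "continuous_on S (\<lambda>z. snd z i)"
    for S :: "((nat \<Rightarrow> real) \<times> (nat \<Rightarrow> real)) set" and i
    by (rule continuous_on_product_then_coordinatewise, intro continuous_intros)+
  then have "continuous_on (unit_fun p \<times> unit_fun q) g"
    unfolding g_def by (intro continuous_intros) auto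
  moreover have "unit_fun p \<times> unit_fun q \<noteq> {}"
    using unit_fun_nonempty[OF assms(1)] unit_fun_nonempty[OF assms(2)] by blast
  ultimately have "\<exists>z\<in>unit_fun p \<times> unit_fun q. \<forall>z'\<in>unit_fun p \<times> unit_fun q. g z' \<le> g z"
    by (intro continuous_attains_sup compact_Times compact_unit_fun)
  then obtain z where z: "z \<in> unit_fun p \<times> unit_fun q"
      "\<And>z'. z' \<in> unit_fun p \<times> unit_fun q \<Longrightarrow> g z' \<le> g z"
    by blast
  define u v \<sigma> where "u = fst z" and "v = snd z" and "\<sigma> = g z"
  have u: "u \<in> unit_fun p" and v: "v \<in> unit_fun q"
    using z(1) by (auto simp: u_def v_def)
  have gz: "(\<Sum>i<p. \<Sum>j<q. u i * B i j * v j) = \<sigma>"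
    by (simp add: \<sigma>_def g_def u_def v_def)
  have max: "(\<Sum>i<p. \<Sum>j<q. x i * B i j * y j) \<le> \<sigma>" if "x \<in> unit_fun p" "y \<in> unit_fun q" for x y
    using z(2)[of "(x, y)"] that by (simp add: g_def \<sigma>_def)
  \<comment> \<open>Flipping the sign of \<open>u\<close> negates the value of the form, so a
    negative maximum is impossible.\<close>
  have "(\<lambda>i. - u i) \<in> unit_fun p" using u by (simp add: unit_fun_def)
  from max[OF this v] have "- \<sigma> \<le> \<sigma>" by (simp add: gz sum_negf)
  then have "0 \<le> \<sigma>" by simp
  \<comment> \<open>With one argument fixed the form is a scalar product in the other, so each
    singular vector equation is an instance of \<open>unit_maximizer_proportional\<close>.\<close>
  have r: "(\<Sum>i<p. \<Sum>j<q. x i * B i j * y j) = (\<Sum>i<p. x i * (\<Sum>j<q. B i j * y j))" for x y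
    by (simp add: sum_distrib_left mult.assoc)
  have c: "(\<Sum>i<p. \<Sum>j<q. x i * B i j * y j) = (\<Sum>j<q. y j * (\<Sum>i<p. B i j * x i))" for x y
    by (subst sum.swap) (simp add: sum_distrib_left mult_ac)
  show thesis
  proof (rule that[OF u v \<open>0 \<le> \<sigma>\<close> _ _ max])
    show "(\<Sum>j<q. B i j * v j) = \<sigma> * u i" if "i < p" for i
      by (rule unit_maximizer_proportional[OF u _ _ \<open>0 \<le> \<sigma>\<close> that]) (use max v gz r in auto)
    show "(\<Sum>i<p. B i j * u i) = \<sigma> * v j" if "j < q" for j
      by (rule unit_maximizer_proportional[OF v _ _ \<open>0 \<le> \<sigma>\<close> that]) (use max u gz c in auto)
  qed
qed

section \<open>Orthogonal matrices and completion of a unit vector\<close>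

lemma orthogonal_matrix_right_inverse:
  assumes "orthogonal_matrix n U"
  shows "U * transpose_mat U = 1\<^sub>m n"
  using assms mat_mult_left_right_inverse[of "transpose_mat U" n U]
  by (auto simp: orthogonal_matrix_def)

lemma orthogonal_matrix_mult:
  assumes "orthogonal_matrix n U" "orthogonal_matrix n V"
  shows "orthogonal_matrix n (U * V)"
proof -
  have [simp]: "U \<in> carrier_mat n n" "V \<in> carrier_mat n n"
    using assms by (auto simp: orthogonal_matrix_def)
  have "transpose_mat (U * V) * (U * V) = transpose_mat V * ((transpose_mat U * U) * V)"
    by (simp add: transpose_mult[of _ n n _ n] assoc_mult_mat[of _ n n _ n _ n] mult_carrier_mat[of _ n n _ n])
  also have "\<dots> = 1\<^sub>m n"
    using assms by (simp add: orthogonal_matrix_def left_mult_one_mat[of _ n n])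
  finally show ?thesis by (simp add: orthogonal_matrix_def mult_carrier_mat[of _ n n _ n])
qed

lemma orthogonal_matrix_col_norm:
  assumes "orthogonal_matrix n U" "j < n"
  shows "(\<lambda>i. if i < n then U $$ (i, j) else 0) \<in> unit_fun n"
proof -
  have U: "U \<in> carrier_mat n n" and "(transpose_mat U * U) $$ (j, j) = 1"
    using assms by (auto simp: orthogonal_matrix_def)
  then have "(\<Sum>i<n. (U $$ (i, j))\<^sup>2) = 1"
    using assms(2) by (simp add: scalar_prod_def power2_eq_square lessThan_atLeast0)
  then show ?thesis by (simp add: unit_fun_def)
qed

text \<open>The Householder reflection exchanging the first basis vector and \<open>u\<close>.\<close>

lemma orthogonal_matrix_first_column:
  assumes "0 < n" and u: "u \<in> unit_fun n"
  obtains H where "orthogonal_matrix n H" "\<And>i. i < n \<Longrightarrow> H $$ (i, 0) = u i"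
proof (cases "u 0 = 1")
  case True
  \<comment> \<open>The first coordinate exhausts the norm, so \<open>u\<close> is the first basis
    vector and the identity matrix serves. The reflection would need a nonzero
    \<open>w\<close>.\<close>
  have "(\<Sum>i<n. (u i)\<^sup>2) = (u 0)\<^sup>2 + (\<Sum>i\<in>{..<n} - {0}. (u i)\<^sup>2)"
    using \<open>0 < n\<close> by (subst sum.remove[of _ 0]) auto
  then have "(\<Sum>i\<in>{..<n} - {0}. (u i)\<^sup>2) = 0"
    using u True by (simp add: unit_fun_def)
  then have "u i = 0" if "i < n" "i \<noteq> 0" for i
    using that by (subst (asm) sum_nonneg_eq_0_iff) auto
  then show thesis
    using True \<open>0 < n\<close> by (intro that[of "1\<^sub>m n"]) (auto simp: orthogonal_matrix_def)
next
  case False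
  define w where "w i = u i - (if i = 0 then 1 else 0)" for i
  \<comment> \<open>This is 2 / |w|^2, because |w|^2 = 2 (1 - u 0) for a unit vector
    \<open>u\<close>; hence the cross terms of H^T H cancel against its quadratic term.\<close>
  define a where "a = 1 / (1 - u 0)"
  define H where "H = mat n n (\<lambda>(i, j). (if i = j then 1 else 0) - a * w i * w j)"
  have nz: "1 - u 0 \<noteq> 0" using False by simp
  have "(\<Sum>i<n. (w i)\<^sup>2) = (\<Sum>i<n. (u i)\<^sup>2 + (if i = 0 then 1 - 2 * u 0 else 0))"
    by (intro sum.cong) (auto simp: w_def power2_eq_square algebra_simps)
  also have "\<dots> = 2 * (1 - u 0)"
    using u \<open>0 < n\<close> by (simp add: sum.distrib unit_fun_def)
  finally have ww: "a * (\<Sum>i<n. w i * w i) = 2" using nz by (simp add: a_def power2_eq_square field_simps)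
  have "transpose_mat H * H = 1\<^sub>m n"
  proof (rule eq_matI)
    fix i j assume "i < dim_row (1\<^sub>m n)" "j < dim_col (1\<^sub>m n)"
    then have ij: "i < n" "j < n" by auto
    have "(transpose_mat H * H) $$ (i, j) = (\<Sum>k<n. H $$ (k, i) * H $$ (k, j))"
      using ij by (simp add: H_def scalar_prod_def lessThan_atLeast0)
    also have "\<dots> = (\<Sum>k<n. (if k = i then (if i = j then 1 else 0) - a * w i * w j else 0)
        - (if k = j then a * w i * w j else 0) + a * a * w i * w j * (w k * w k))"
      using ij by (intro sum.cong) (auto simp: H_def algebra_simps)
    also have "\<dots> = (if i = j then 1 else 0) - 2 * a * w i * w j + a * w i * w j * (a * (\<Sum>k<n. w k * w k))"
      using ij by (simp add: sum.distrib sum_subtractf sum_distrib_left mult_ac)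
    also have "\<dots> = 1\<^sub>m n $$ (i, j)"
      using ij by (simp add: ww)
    finally show "(transpose_mat H * H) $$ (i, j) = 1\<^sub>m n $$ (i, j)" .
  qed (auto simp: H_def)
  then have "orthogonal_matrix n H" by (simp add: orthogonal_matrix_def H_def)
  moreover have "H $$ (i, 0) = u i" if "i < n" for i
    using that \<open>0 < n\<close> nz by (auto simp: H_def a_def w_def field_simps)
  ultimately show thesis by (rule that)
qed

section \<open>Block matrices and the deflation argument\<close>

definition rect_diag :: "nat \<Rightarrow> nat \<Rightarrow> (nat \<Rightarrow> real) \<Rightarrow> real mat" where
  "rect_diag p q \<sigma> = mat p q (\<lambda>(i, j). if i = j then \<sigma> i else 0)"

lemma rect_diag_carrier [simp]: "rect_diag p q \<sigma> \<in> carrier_mat p q"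
  "dim_row (rect_diag p q \<sigma>) = p" "dim_col (rect_diag p q \<sigma>) = q"
  by (auto simp: rect_diag_def)

text \<open>Acts as \<open>U\<close> on all coordinates but the first, which turns a decomposition
  of the deflated block into one of the whole matrix.\<close>

definition shift_diag :: "real mat \<Rightarrow> nat \<Rightarrow> real mat" where
  "shift_diag U n = four_block_mat (1\<^sub>m 1) (0\<^sub>m 1 n) (0\<^sub>m n 1) U"

lemma orthogonal_matrix_shift_diag:
  assumes "orthogonal_matrix n U"
  shows "orthogonal_matrix (Suc n) (shift_diag U n)"
proof -
  have U: "U \<in> carrier_mat n n" and UU: "transpose_mat U * U = 1\<^sub>m n"
    using assms by (auto simp: orthogonal_matrix_def)
  have "transpose_mat (shift_diag U n) = four_block_mat (1\<^sub>m 1) (0\<^sub>m 1 n) (0\<^sub>m n 1) (transpose_mat U)"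
    unfolding shift_diag_def using U by (subst transpose_four_block_mat[of _ 1 1 _ n _ n]) auto
  then have "transpose_mat (shift_diag U n) * shift_diag U n
      = four_block_mat (1\<^sub>m 1) (0\<^sub>m 1 n) (0\<^sub>m n 1) (1\<^sub>m n)"
    unfolding shift_diag_def using U UU by (simp add: mult_four_block_mat[of _ 1 1 _ n _ n _ _ 1 _ n])
  also have "\<dots> = 1\<^sub>m (Suc n)" by (auto intro!: eq_matI)
  finally show ?thesis
    using U four_block_carrier_mat[of "1\<^sub>m 1" 1 1 U n n] by (simp add: orthogonal_matrix_def shift_diag_def)
qed

lemma is_svd_iff:
  assumes "B \<in> carrier_mat p q"
  shows "is_svd B U \<sigma> V \<longleftrightarrow> orthogonal_matrix p U \<and> orthogonal_matrix q V \<and>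
     (\<forall>i<min p q. 0 \<le> \<sigma> i) \<and> (\<forall>i j. i \<le> j \<and> j < min p q \<longrightarrow> \<sigma> j \<le> \<sigma> i) \<and>
     B = U * rect_diag p q \<sigma> * transpose_mat V"
  using assms by (auto simp: is_svd_def rect_diag_def)

text \<open>Read off the diagonal of U^T B V. Each singular value is thus a value of the bilinear
  form at unit vectors, so the maximum of the form bounds it.\<close>

lemma svd_bilinear:
  assumes "orthogonal_matrix p U" "orthogonal_matrix q V"
    and B_eq: "B = U * rect_diag p q \<sigma> * transpose_mat V" and l: "l < min p q"
  shows "(\<Sum>i<p. \<Sum>j<q. U $$ (i, l) * B $$ (i, j) * V $$ (j, l)) = \<sigma> l"
proof -
  have U: "U \<in> carrier_mat p p" "transpose_mat U * U = 1\<^sub>m p"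
    and V: "V \<in> carrier_mat q q" "transpose_mat V * V = 1\<^sub>m q"
    using assms by (auto simp: orthogonal_matrix_def)
  have B: "B \<in> carrier_mat p q" using U V by (simp add: B_eq mult_carrier_mat[of _ p p _ q] mult_carrier_mat[of _ p q _ q])
  let ?D = "rect_diag p q \<sigma>"
  have "transpose_mat U * (B * V) = transpose_mat U * (U * (?D * (transpose_mat V * V)))"
    using U V by (simp add: B_eq assoc_mult_mat[of _ p p _ q _ q] assoc_mult_mat[of _ p q _ q _ q]
        mult_carrier_mat[of _ p q _ q])
  also have "\<dots> = transpose_mat U * (U * ?D)"
    using V by simp
  also have "\<dots> = (transpose_mat U * U) * ?D"
    using U(1) by (intro assoc_mult_mat[symmetric]) auto
  finally have eq: "transpose_mat U * (B * V) = ?D" using U by simp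
  have "\<sigma> l = (transpose_mat U * (B * V)) $$ (l, l)"
    using l by (simp add: eq rect_diag_def)
  also have "\<dots> = (\<Sum>i<p. \<Sum>j<q. U $$ (i, l) * B $$ (i, j) * V $$ (j, l))"
    using l U(1) V(1) B by (simp add: scalar_prod_def lessThan_atLeast0 sum_distrib_left mult.assoc)
  finally show ?thesis by simp
qed

text \<open>Induction on the number of rows by deflation: split off a maximizing pair of singular
  vectors, rotate it onto the first coordinates, and decompose the remaining block. An empty matrix
  admits any orthogonal factors.\<close>

theorem svd_exists:
  assumes "B \<in> carrier_mat p q"
  shows "\<exists>U \<sigma> V. is_svd B U \<sigma> V"
  using assms
proof (induction p arbitrary: q B)
  case 0
  then have "is_svd B (1\<^sub>m 0) (\<lambda>_. 0) (1\<^sub>m q)"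
    by (auto simp: is_svd_iff[OF 0] orthogonal_matrix_def intro!: eq_matI)
  then show ?case by blast
next
  case (Suc p q' B)
  note B = Suc.prems
  show ?case
  proof (cases q')
    case 0
    then have "is_svd B (1\<^sub>m (Suc p)) (\<lambda>_. 0) (1\<^sub>m q')"
      using B by (auto simp: is_svd_iff[OF B] orthogonal_matrix_def intro!: eq_matI)
    then show ?thesis by blast
  next
    case q': (Suc q)
    obtain u v \<tau> where u: "u \<in> unit_fun (Suc p)" and v: "v \<in> unit_fun q'" and "0 \<le> \<tau>"
      and Bv: "\<And>i. i < Suc p \<Longrightarrow> (\<Sum>j<q'. B $$ (i, j) * v j) = \<tau> * u i"
      and Bu: "\<And>j. j < q' \<Longrightarrow> (\<Sum>i<Suc p. B $$ (i, j) * u i) = \<tau> * v j"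
      and max: "\<And>x y. x \<in> unit_fun (Suc p) \<Longrightarrow> y \<in> unit_fun q' \<Longrightarrow>
        (\<Sum>i<Suc p. \<Sum>j<q'. x i * B $$ (i, j) * y j) \<le> \<tau>"
      using top_singular_pair[of "Suc p" q' "\<lambda>i j. B $$ (i, j)"] q' by blast
    obtain G where G: "orthogonal_matrix (Suc p) G" "\<And>i. i < Suc p \<Longrightarrow> G $$ (i, 0) = u i"
      using orthogonal_matrix_first_column[OF _ u] by blast
    obtain H where H: "orthogonal_matrix q' H" "\<And>i. i < q' \<Longrightarrow> H $$ (i, 0) = v i"
      using orthogonal_matrix_first_column[OF _ v] q' by blast
    have Gc: "G \<in> carrier_mat (Suc p) (Suc p)" "transpose_mat G * G = 1\<^sub>m (Suc p)"
      and Hc: "H \<in> carrier_mat q' q'" "transpose_mat H * H = 1\<^sub>m q'"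
      using G H by (auto simp: orthogonal_matrix_def)
    \<comment> \<open>\<open>B\<close> in the rotated bases. Its first row and column vanish except
      for the corner \<open>\<tau>\<close>.\<close>
    define M where "M = transpose_mat G * B * H"
    have M: "M \<in> carrier_mat (Suc p) q'" using Gc Hc B by (simp add: M_def)
    have M_nth: "M $$ (a, b) = (\<Sum>i<Suc p. \<Sum>j<q'. G $$ (i, a) * B $$ (i, j) * H $$ (j, b))"
      if "a < Suc p" "b < q'" for a b
    proof -
      have "M = transpose_mat G * (B * H)"
        unfolding M_def using Gc Hc B by (intro assoc_mult_mat) auto
      then show ?thesis
        using that Gc(1) Hc(1) B
        by (simp add: scalar_prod_def lessThan_atLeast0 sum_distrib_left mult.assoc del: sum.lessThan_Suc sum.op_ivl_Suc)
    qed
    have GG: "(\<Sum>i<Suc p. G $$ (i, a) * G $$ (i, b)) = (if a = b then 1 else 0)"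
      if "a < Suc p" "b < Suc p" for a b
    proof -
      have "(transpose_mat G * G) $$ (a, b) = (if a = b then 1 else 0)"
        using that by (simp add: Gc)
      then show ?thesis
        using that Gc(1) by (simp add: scalar_prod_def lessThan_atLeast0 del: sum.lessThan_Suc sum.op_ivl_Suc)
    qed
    have HH: "(\<Sum>i<q'. H $$ (i, a) * H $$ (i, b)) = (if a = b then 1 else 0)"
      if "a < q'" "b < q'" for a b
    proof -
      have "(transpose_mat H * H) $$ (a, b) = (if a = b then 1 else 0)"
        using that by (simp add: Hc)
      then show ?thesis
        using that Hc(1) by (simp add: scalar_prod_def lessThan_atLeast0 del: sum.lessThan_Suc sum.op_ivl_Suc)
    qed
    \<comment> \<open>\<open>B\<close> maps \<open>v\<close> to a multiple of \<open>u\<close>, the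
      first column of \<open>G\<close>, and the other columns of \<open>G\<close> are orthogonal to
      it. The first row is treated symmetrically.\<close>
    have M_col: "M $$ (a, 0) = (if a = 0 then \<tau> else 0)" if "a < Suc p" for a
    proof -
      have "M $$ (a, 0) = (\<Sum>i<Suc p. G $$ (i, a) * (\<Sum>j<q'. B $$ (i, j) * v j))"
        using that q' by (subst M_nth) (simp_all add: H(2) sum_distrib_left mult.assoc del: sum.lessThan_Suc)
      also have "\<dots> = \<tau> * (\<Sum>i<Suc p. G $$ (i, a) * G $$ (i, 0))"
        unfolding sum_distrib_left[of \<tau>] by (intro sum.cong refl, subst Bv) (auto simp: G(2))
      finally show ?thesis using that by (subst (asm) GG) auto
    qed
    have M_row: "M $$ (0, b) = (if b = 0 then \<tau> else 0)" if "b < q'" for b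
    proof -
      have "M $$ (0, b) = (\<Sum>j<q'. H $$ (j, b) * (\<Sum>i<Suc p. B $$ (i, j) * u i))"
        using that q' by (subst M_nth, simp, simp, subst sum.swap)
          (simp_all add: G(2) sum_distrib_left mult_ac del: sum.lessThan_Suc)
      also have "\<dots> = \<tau> * (\<Sum>j<q'. H $$ (j, b) * H $$ (j, 0))"
        unfolding sum_distrib_left[of \<tau>] by (intro sum.cong refl, subst Bu) (auto simp: H(2))
      finally show ?thesis using that q' by (subst (asm) HH) auto
    qed
    define B' where "B' = mat p q (\<lambda>(i, j). M $$ (Suc i, Suc j))"
    have B': "B' \<in> carrier_mat p q" by (simp add: B'_def)
    obtain U' \<sigma>' V' where svd': "is_svd B' U' \<sigma>' V'" using Suc.IH[OF B'] by blast
    have U': "orthogonal_matrix p U'" and V': "orthogonal_matrix q V'"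
      and nonneg': "\<And>i. i < min p q \<Longrightarrow> 0 \<le> \<sigma>' i"
      and sorted': "\<And>i j. i \<le> j \<Longrightarrow> j < min p q \<Longrightarrow> \<sigma>' j \<le> \<sigma>' i"
      and B'_eq: "B' = U' * rect_diag p q \<sigma>' * transpose_mat V'"
      using svd' by (auto simp: is_svd_iff[OF B'])
    have Uc': "U' \<in> carrier_mat p p" and Vc': "V' \<in> carrier_mat q q"
      using U' V' by (auto simp: orthogonal_matrix_def)
    \<comment> \<open>Undoing the deflation: the inner factors act below the first coordinate, and
      \<open>\<tau>\<close> goes in front of the singular values of the block, shifting their
      indices by one.\<close>
    define U V \<sigma> where "U = G * shift_diag U' p" and "V = H * shift_diag V' q"
      and "\<sigma> = case_nat \<tau> \<sigma>'"
    have U: "orthogonal_matrix (Suc p) U" and V: "orthogonal_matrix q' V"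
      unfolding U_def V_def q'
      using orthogonal_matrix_mult[OF G(1) orthogonal_matrix_shift_diag[OF U']]
        orthogonal_matrix_mult[OF H(1)[unfolded q'] orthogonal_matrix_shift_diag[OF V']] by auto
    have Uc: "U \<in> carrier_mat (Suc p) (Suc p)" and Vc: "V \<in> carrier_mat q' q'"
      using U V by (auto simp: orthogonal_matrix_def)
    have sU: "shift_diag U' p \<in> carrier_mat (Suc p) (Suc p)"
      and sV: "shift_diag V' q \<in> carrier_mat q' q'"
      using Uc' Vc' q' by (auto simp: shift_diag_def)
    have sV_T: "transpose_mat (shift_diag V' q) = four_block_mat (1\<^sub>m 1) (0\<^sub>m 1 q) (0\<^sub>m q 1) (transpose_mat V')"
      unfolding shift_diag_def using Vc' by (subst transpose_four_block_mat[of _ 1 1 _ q _ q]) auto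
    have D: "rect_diag (Suc p) q' \<sigma> = four_block_mat (mat 1 1 (\<lambda>_. \<tau>)) (0\<^sub>m 1 q) (0\<^sub>m p 1) (rect_diag p q \<sigma>')"
      by (rule eq_matI) (auto simp: rect_diag_def q' \<sigma>_def split: nat.splits)
    have M_block: "M = four_block_mat (mat 1 1 (\<lambda>_. \<tau>)) (0\<^sub>m 1 q) (0\<^sub>m p 1) B'"
    proof (rule eq_matI)
      fix i j assume "i < dim_row (four_block_mat (mat 1 1 (\<lambda>_. \<tau>)) (0\<^sub>m 1 q) (0\<^sub>m p 1) B')"
        "j < dim_col (four_block_mat (mat 1 1 (\<lambda>_. \<tau>)) (0\<^sub>m 1 q) (0\<^sub>m p 1) B')"
      then have "i < Suc p" "j < q'" using B' q' by auto
      then show "M $$ (i, j) = four_block_mat (mat 1 1 (\<lambda>_. \<tau>)) (0\<^sub>m 1 q) (0\<^sub>m p 1) B' $$ (i, j)"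
        using B' q' M_col[of i] M_row[of j] by (auto simp: B'_def)
    qed (use M B' q' in auto)
    have "shift_diag U' p * rect_diag (Suc p) q' \<sigma> * transpose_mat (shift_diag V' q) = M"
      unfolding M_block B'_eq D sV_T unfolding shift_diag_def using Uc' Vc'
      by (subst mult_four_block_mat[of _ 1 1 _ p _ p _ _ 1 _ q], simp_all)
        (subst mult_four_block_mat[of _ 1 1 _ q _ p _ _ 1 _ q],
          simp_all add: left_add_zero_mat[of _ p q] mult_carrier_mat[of _ p p _ q] mult_carrier_mat[of _ p q _ q])
    moreover have "U * rect_diag (Suc p) q' \<sigma> * transpose_mat V
        = G * (shift_diag U' p * rect_diag (Suc p) q' \<sigma> * transpose_mat (shift_diag V' q)) * transpose_mat H"
      unfolding U_def V_def using Gc(1) Hc(1) sU sV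
      by (simp add: transpose_mult[of _ q' q' _ q'] assoc_mult_mat[of _ "Suc p" "Suc p" _ "Suc p" _ q']
          assoc_mult_mat[of _ "Suc p" "Suc p" _ q' _ q'] assoc_mult_mat[of _ "Suc p" q' _ q' _ q']
          mult_carrier_mat[of _ "Suc p" "Suc p" _ q'] mult_carrier_mat[of _ "Suc p" q' _ q']
          mult_carrier_mat[of _ q' q' _ q'])
    moreover have "G * M * transpose_mat H = (G * transpose_mat G) * B * (H * transpose_mat H)"
      unfolding M_def using Gc(1) Hc(1) B
      by (simp add: assoc_mult_mat[of _ "Suc p" "Suc p" _ "Suc p" _ q']
          assoc_mult_mat[of _ "Suc p" "Suc p" _ q' _ q'] assoc_mult_mat[of _ "Suc p" q' _ q' _ q']
          mult_carrier_mat[of _ "Suc p" "Suc p" _ q'] mult_carrier_mat[of _ "Suc p" q' _ q']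
          mult_carrier_mat[of _ q' q' _ q'])
    ultimately have B_eq: "B = U * rect_diag (Suc p) q' \<sigma> * transpose_mat V"
      using B by (simp add: orthogonal_matrix_right_inverse[OF G(1)] orthogonal_matrix_right_inverse[OF H(1)])
    \<comment> \<open>The induction hypothesis orders the values of the block only among themselves.
      That \<open>\<tau>\<close> dominates them follows from its maximality over all unit vectors;
      the columns get a zero tail so as to lie in \<open>unit_fun\<close>.\<close>
    have le_\<tau>: "\<sigma> l \<le> \<tau>" if "l < min (Suc p) q'" for l
    proof -
      have "\<sigma> l = (\<Sum>i<Suc p. \<Sum>j<q'. (if i < Suc p then U $$ (i, l) else 0) * B $$ (i, j)
          * (if j < q' then V $$ (j, l) else 0))"
        unfolding svd_bilinear[OF U V B_eq that, symmetric] by (intro sum.cong) auto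
      also have "\<dots> \<le> \<tau>"
        using that by (intro max orthogonal_matrix_col_norm U V) auto
      finally show ?thesis .
    qed
    have "is_svd B U \<sigma> V"
      unfolding is_svd_iff[OF B]
    proof (intro conjI allI impI U V B_eq)
      show "0 \<le> \<sigma> i" if "i < min (Suc p) q'" for i
        using that nonneg' \<open>0 \<le> \<tau>\<close> q' by (auto simp: \<sigma>_def split: nat.splits)
      show "\<sigma> j \<le> \<sigma> i" if ij: "i \<le> j \<and> j < min (Suc p) q'" for i j
      proof (cases i)
        case 0
        then show ?thesis using le_\<tau>[of j] ij by (simp add: \<sigma>_def)
      next
        case (Suc i')
        then obtain j' where "j = Suc j'" using ij by (cases j) auto
        then show ?thesis using sorted'[of i' j'] ij Suc q' by (simp add: \<sigma>_def)
      qed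
    qed
    then show ?thesis by blast
  qed
qed

subsection \<open>Frobenius norms and orthonormal columns\<close>

text \<open>The trace inner product, which allows arguing with squared norms throughout. Its
  summation ranges come from the first argument alone, so the lemmas fix common dimensions.\<close>

definition frob_inner :: "real mat \<Rightarrow> real mat \<Rightarrow> real" where
  "frob_inner X Y = (\<Sum>i<dim_row X. \<Sum>j<dim_col X. X $$ (i, j) * Y $$ (i, j))"

lemma frobenius_norm_sq: "(frobenius_norm A)\<^sup>2 = frob_inner A A"
  by (simp add: frobenius_norm_def frob_inner_def sum_nonneg power2_eq_square)

lemma frob_inner_nonneg: "0 \<le> frob_inner A A"
  by (simp flip: frobenius_norm_sq)

lemma frob_inner_transpose:
  assumes "X \<in> carrier_mat n d" "Y \<in> carrier_mat n d"
  shows "frob_inner (transpose_mat X) (transpose_mat Y) = frob_inner X Y"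
  using assms by (simp add: frob_inner_def) (rule sum.swap)

lemma frob_inner_diff:
  assumes "X \<in> carrier_mat n d" "Y \<in> carrier_mat n d"
  shows "frob_inner (X - Y) (X - Y) = frob_inner X X - 2 * frob_inner X Y + frob_inner Y Y"
  using assms
  by (simp add: frob_inner_def algebra_simps sum.distrib sum_subtractf sum_distrib_left)

text \<open>Right multiplications by \<open>W\<close> and by its transpose are adjoint: both sides
  are the same triple sum in a different order.\<close>

lemma frob_inner_mult_transpose:
  assumes "X \<in> carrier_mat n d" "Z \<in> carrier_mat n k" "W \<in> carrier_mat d k"
  shows "frob_inner X (Z * transpose_mat W) = frob_inner (X * W) Z"
proof -
  have "frob_inner X (Z * transpose_mat W)
      = (\<Sum>i<n. \<Sum>j<d. \<Sum>l<k. X $$ (i, j) * W $$ (j, l) * Z $$ (i, l))"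
    using assms
    by (simp add: frob_inner_def scalar_prod_def lessThan_atLeast0 sum_distrib_left mult_ac)
  also have "\<dots> = (\<Sum>i<n. \<Sum>l<k. \<Sum>j<d. X $$ (i, j) * W $$ (j, l) * Z $$ (i, l))"
    by (intro sum.cong refl sum.swap)
  also have "\<dots> = frob_inner (X * W) Z"
    using assms
    by (simp add: frob_inner_def scalar_prod_def lessThan_atLeast0 sum_distrib_left sum_distrib_right mult_ac)
  finally show ?thesis .
qed

section \<open>Matrices with orthonormal columns\<close>

definition orthonormal_cols :: "nat \<Rightarrow> nat \<Rightarrow> real mat \<Rightarrow> bool" where
  "orthonormal_cols d k W \<longleftrightarrow> W \<in> carrier_mat d k \<and> transpose_mat W * W = 1\<^sub>m k"

lemma orthonormal_cols_carrier: "orthonormal_cols d k W \<Longrightarrow> W \<in> carrier_mat d k"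
  by (simp add: orthonormal_cols_def)

lemma orthogonal_matrix_iff: "orthogonal_matrix n U \<longleftrightarrow> orthonormal_cols n n U"
  by (simp add: orthogonal_matrix_def orthonormal_cols_def)

lemma orthonormal_cols_mult:
  assumes "orthonormal_cols n m U" "orthonormal_cols m k V"
  shows "orthonormal_cols n k (U * V)"
proof -
  have U: "U \<in> carrier_mat n m" "transpose_mat U * U = 1\<^sub>m m"
    and V: "V \<in> carrier_mat m k" "transpose_mat V * V = 1\<^sub>m k"
    using assms by (auto simp: orthonormal_cols_def)
  have "transpose_mat (U * V) * (U * V) = transpose_mat V * ((transpose_mat U * U) * V)"
    using U(1) V(1)
    by (simp add: transpose_mult[of _ n m _ k] assoc_mult_mat[of _ k m _ n _ k]
        assoc_mult_mat[of _ m n _ m _ k] mult_carrier_mat[of _ n m _ k])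
  then show ?thesis using U V by (simp add: orthonormal_cols_def)
qed

lemma orthonormal_cols_sum:
  assumes "orthonormal_cols d k W" "a < k" "b < k"
  shows "(\<Sum>i<d. W $$ (i, a) * W $$ (i, b)) = (if a = b then 1 else 0)"
proof -
  have "W \<in> carrier_mat d k" "(transpose_mat W * W) $$ (a, b) = (if a = b then 1 else 0)"
    using assms by (auto simp: orthonormal_cols_def)
  then show ?thesis using assms(2,3) by (simp add: scalar_prod_def lessThan_atLeast0)
qed

lemma frob_inner_orthonormal_cols:
  assumes "orthonormal_cols d k W"
  shows "frob_inner W W = real k"
proof -
  have W: "W \<in> carrier_mat d k" using assms by (rule orthonormal_cols_carrier)
  have "frob_inner W W = (\<Sum>l<k. \<Sum>i<d. W $$ (i, l) * W $$ (i, l))"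
    using W by (simp add: frob_inner_def) (rule sum.swap)
  also have "\<dots> = (\<Sum>l<k. 1)" by (intro sum.cong refl) (simp add: orthonormal_cols_sum[OF assms])
  finally show ?thesis by simp
qed

text \<open>The sum \<open>t\<close> is a diagonal entry of the projection W W^T, and
  \<open>y\<close> is the row through that entry. Idempotence gives |y|^2 = t, while
  \<open>t\<close> is itself a coordinate of \<open>y\<close>, so t^2 <= t.\<close>

lemma orthonormal_cols_row_le:
  assumes W: "orthonormal_cols d k W" and i: "i < d"
  shows "(\<Sum>l<k. (W $$ (i, l))\<^sup>2) \<le> 1"
proof -
  define t where "t = (\<Sum>l<k. (W $$ (i, l))\<^sup>2)"
  define y where "y j = (\<Sum>l<k. W $$ (i, l) * W $$ (j, l))" for j
  have "y i = t" by (simp add: y_def t_def power2_eq_square)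
  have "(\<Sum>j<d. (y j)\<^sup>2) = (\<Sum>j<d. \<Sum>l<k. \<Sum>m<k. W $$ (i, l) * W $$ (i, m) * (W $$ (j, l) * W $$ (j, m)))"
    by (simp add: y_def power2_eq_square sum_product mult_ac)
  also have "\<dots> = (\<Sum>l<k. \<Sum>j<d. \<Sum>m<k. W $$ (i, l) * W $$ (i, m) * (W $$ (j, l) * W $$ (j, m)))"
    by (rule sum.swap)
  also have "\<dots> = (\<Sum>l<k. \<Sum>m<k. \<Sum>j<d. W $$ (i, l) * W $$ (i, m) * (W $$ (j, l) * W $$ (j, m)))"
    by (rule sum.cong[OF refl], rule sum.swap)
  also have "\<dots> = (\<Sum>l<k. \<Sum>m<k. W $$ (i, l) * W $$ (i, m) * (\<Sum>j<d. W $$ (j, l) * W $$ (j, m)))"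
    by (simp only: sum_distrib_left)
  also have "\<dots> = t"
    by (simp add: orthonormal_cols_sum[OF W] t_def power2_eq_square if_distrib[of "\<lambda>x. _ * x"] cong: if_cong)
  finally have yy: "(\<Sum>j<d. (y j)\<^sup>2) = t" .
  have "(y i)\<^sup>2 \<le> (\<Sum>j<d. (y j)\<^sup>2)" using i by (intro member_le_sum) auto
  then have "t * t \<le> t" unfolding yy \<open>y i = t\<close> by (simp add: power2_eq_square)
  then have "t \<le> 1" using mult_strict_left_mono[of 1 t t] by (cases "t > 1") auto
  then show ?thesis by (simp add: t_def)
qed

text \<open>Pythagoras: by adjointness and W^T W = 1, the projected matrix has the same inner
  product with itself as with \<open>A\<close>, namely the squared norm of A W.\<close>

lemma frob_residual:
  assumes A: "A \<in> carrier_mat n d" and "orthonormal_cols d k W"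
  shows "frob_inner (A - A * (W * transpose_mat W)) (A - A * (W * transpose_mat W))
      = frob_inner A A - frob_inner (A * W) (A * W)"
proof -
  have W: "W \<in> carrier_mat d k" "transpose_mat W * W = 1\<^sub>m k"
    using assms by (auto simp: orthonormal_cols_def)
  let ?Z = "A * W"
  have Z: "?Z \<in> carrier_mat n k" using A W by simp
  have eq: "A * (W * transpose_mat W) = ?Z * transpose_mat W"
    using A W by (intro assoc_mult_mat[symmetric]) auto
  have "?Z * transpose_mat W * W = ?Z * (transpose_mat W * W)"
    using Z W(1) by (intro assoc_mult_mat) auto
  then have "?Z * transpose_mat W * W = ?Z" using Z W by simp
  then have "frob_inner (?Z * transpose_mat W) (?Z * transpose_mat W) = frob_inner ?Z ?Z"
    using Z W by (subst frob_inner_mult_transpose[of _ n d _ k]) (auto simp: mult_carrier_mat[of _ n k _ d])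
  moreover have "frob_inner A (?Z * transpose_mat W) = frob_inner ?Z ?Z"
    using Z W A by (intro frob_inner_mult_transpose) auto
  ultimately show ?thesis
    unfolding eq using Z W A
    by (subst frob_inner_diff[of _ n d]) (auto simp: mult_carrier_mat[of _ n k _ d])
qed

lemma frob_mult_orthonormal_le:
  assumes "A \<in> carrier_mat n d" "orthonormal_cols d k W"
  shows "frob_inner (A * W) (A * W) \<le> frob_inner A A"
  using frob_residual[OF assms] frob_inner_nonneg[of "A - A * (W * transpose_mat W)"] by simp

text \<open>Transposition turns the left factor into a right factor, to which adjointness
  applies.\<close>

lemma frob_orthogonal_mult:
  assumes U: "orthogonal_matrix n U" and X: "X \<in> carrier_mat n k"
  shows "frob_inner (U * X) (U * X) = frob_inner X X"
proof -
  have Uc: "U \<in> carrier_mat n n" "transpose_mat U * U = 1\<^sub>m n"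
    using U by (auto simp: orthogonal_matrix_def)
  have T: "transpose_mat (U * X) = transpose_mat X * transpose_mat U"
    using Uc X by (intro transpose_mult) auto
  have "frob_inner (U * X) (U * X) = frob_inner (transpose_mat (U * X)) (transpose_mat (U * X))"
    using frob_inner_transpose[of "U * X" n k "U * X"] Uc X by simp
  also have "\<dots> = frob_inner (transpose_mat X * transpose_mat U * U) (transpose_mat X)"
    unfolding T using Uc X
    by (intro frob_inner_mult_transpose[of _ k n _ n]) (auto simp: mult_carrier_mat[of _ k n _ n])
  also have "transpose_mat X * transpose_mat U * U = transpose_mat X * (transpose_mat U * U)"
    using Uc X by (intro assoc_mult_mat) auto
  also have "\<dots> = transpose_mat X" using Uc X by simp
  also have "frob_inner (transpose_mat X) (transpose_mat X) = frob_inner X X"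
    using frob_inner_transpose[OF X X] .
  finally show ?thesis .
qed

lemma orthogonal_matrix_transpose:
  assumes "orthogonal_matrix n U"
  shows "orthogonal_matrix n (transpose_mat U)"
  using assms orthogonal_matrix_right_inverse[OF assms] by (auto simp: orthogonal_matrix_def)

section \<open>Variational characterization of the top right singular vectors\<close>

text \<open>The left factor preserves the norm, so only the diagonal part acts on V^T Y and scales
  its rows. Weight 0 is put beyond the \<open>p\<close> rows, where \<open>\<sigma>\<close> is
  unconstrained.\<close>

lemma svd_frob:
  assumes B: "B \<in> carrier_mat p q" and svd: "is_svd B U \<sigma> V" and Y: "Y \<in> carrier_mat q k"
  shows "frob_inner (B * Y) (B * Y) =
    (\<Sum>i<q. (if i < p then (\<sigma> i)\<^sup>2 else 0) * (\<Sum>l<k. ((transpose_mat V * Y) $$ (i, l))\<^sup>2))"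
proof -
  have U: "orthogonal_matrix p U" and V: "orthogonal_matrix q V"
    and B_eq: "B = U * rect_diag p q \<sigma> * transpose_mat V"
    using svd by (auto simp: is_svd_iff[OF B])
  have Uc: "U \<in> carrier_mat p p" and Vc: "V \<in> carrier_mat q q"
    using U V by (auto simp: orthogonal_matrix_def)
  define H where "H = transpose_mat V * Y"
  have H: "H \<in> carrier_mat q k" using Vc Y by (simp add: H_def)
  have DH: "rect_diag p q \<sigma> * H = mat p k (\<lambda>(i, l). if i < q then \<sigma> i * H $$ (i, l) else 0)"
  proof (rule eq_matI)
    fix i l assume "i < dim_row (mat p k (\<lambda>(i, l). if i < q then \<sigma> i * H $$ (i, l) else 0))"
      "l < dim_col (mat p k (\<lambda>(i, l). if i < q then \<sigma> i * H $$ (i, l) else 0))"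
    then have "i < p" "l < k" by auto
    then show "(rect_diag p q \<sigma> * H) $$ (i, l) = mat p k (\<lambda>(i, l). if i < q then \<sigma> i * H $$ (i, l) else 0) $$ (i, l)"
      using H by (simp add: scalar_prod_def rect_diag_def if_distrib[of "\<lambda>x. x * _"] cong: if_cong)
  qed (use H in auto)
  have "B * Y = U * (rect_diag p q \<sigma> * H)"
    unfolding B_eq H_def using Uc Vc Y
    by (simp add: assoc_mult_mat[of _ p p _ q _ q] assoc_mult_mat[of _ p p _ q _ k]
        assoc_mult_mat[of _ p q _ q _ k] mult_carrier_mat[of _ p q _ q])
  then have "frob_inner (B * Y) (B * Y) = frob_inner (rect_diag p q \<sigma> * H) (rect_diag p q \<sigma> * H)"
    using frob_orthogonal_mult[OF U, of "rect_diag p q \<sigma> * H" k] H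
    by (simp add: mult_carrier_mat[of _ p q _ k])
  also have "\<dots> = (\<Sum>i<p. (if i < q then (\<sigma> i)\<^sup>2 * (\<Sum>l<k. (H $$ (i, l))\<^sup>2) else 0))"
    unfolding DH frob_inner_def
    by (auto intro!: sum.cong simp: sum_distrib_left power2_eq_square mult_ac)
  \<comment> \<open>The sum passes from row indices of \<open>B\<close> to column indices through
    their intersection; over the latter the squared row norms of V^T Y can be totalled.\<close>
  also have "\<dots> = (\<Sum>i\<in>{..<p} \<inter> {..<q}. (\<sigma> i)\<^sup>2 * (\<Sum>l<k. (H $$ (i, l))\<^sup>2))"
    by (subst sum.inter_restrict) (auto intro!: sum.cong)
  also have "\<dots> = (\<Sum>i\<in>{..<q} \<inter> {..<p}. (\<sigma> i)\<^sup>2 * (\<Sum>l<k. (H $$ (i, l))\<^sup>2))"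
    by (simp add: Int_commute)
  also have "\<dots> = (\<Sum>i<q. (if i < p then (\<sigma> i)\<^sup>2 else 0) * (\<Sum>l<k. (H $$ (i, l))\<^sup>2))"
    by (subst sum.inter_restrict) (auto intro!: sum.cong)
  finally show ?thesis by (simp add: H_def)
qed

text \<open>Subtract the threshold \<open>t\<close>, the k-th largest value. The remainders are
  nonnegative before index \<open>k\<close> and nonpositive from there on, so replacing
  \<open>w\<close> by the indicator of the first \<open>k\<close> indices only increases the sum.
  The subtracted part is at most t k because t >= 0.\<close>

lemma weighted_sum_le_prefix_sum:
  fixes \<tau> w :: "nat \<Rightarrow> real"
  assumes k: "1 \<le> k" "k \<le> q" and anti: "\<And>i j. i \<le> j \<Longrightarrow> j < q \<Longrightarrow> \<tau> j \<le> \<tau> i"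
    and nonneg: "\<And>i. i < q \<Longrightarrow> 0 \<le> \<tau> i"
    and w: "\<And>i. i < q \<Longrightarrow> 0 \<le> w i" "\<And>i. i < q \<Longrightarrow> w i \<le> 1" and sum_w: "(\<Sum>i<q. w i) \<le> real k"
  shows "(\<Sum>i<q. \<tau> i * w i) \<le> (\<Sum>i<k. \<tau> i)"
proof -
  define t where "t = \<tau> (k - 1)"
  have "t \<ge> 0" using nonneg[of "k - 1"] k by (simp add: t_def)
  have "(\<Sum>i<q. (\<tau> i - t) * w i) \<le> (\<Sum>i<q. if i < k then \<tau> i - t else 0)"
  proof (rule sum_mono)
    fix i assume "i \<in> {..<q}"
    then have i: "i < q" by simp
    show "(\<tau> i - t) * w i \<le> (if i < k then \<tau> i - t else 0)"
    proof (cases "i < k")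
      case True
      then have "\<tau> i - t \<ge> 0" using anti[of i "k - 1"] k by (simp add: t_def)
      from mult_left_mono[OF w(2)[OF i] this] show ?thesis using True by simp
    next
      case False
      then have "\<tau> i - t \<le> 0" using anti[of "k - 1" i] i by (simp add: t_def)
      then show ?thesis using False w(1)[OF i] by (simp add: mult_nonpos_nonneg)
    qed
  qed
  also have "\<dots> = (\<Sum>i<k. \<tau> i - t)"
  proof -
    have "{..<q} \<inter> {..<k} = {..<k}" using k by auto
    then show ?thesis using sum.inter_restrict[of "{..<q}" "\<lambda>i. \<tau> i - t" "{..<k}"] by simp
  qed
  finally have "(\<Sum>i<q. \<tau> i * w i) - t * (\<Sum>i<q. w i) \<le> (\<Sum>i<k. \<tau> i) - real k * t"
    by (simp add: algebra_simps sum_subtractf sum_distrib_left)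
  moreover have "t * (\<Sum>i<q. w i) \<le> t * real k" using sum_w \<open>t \<ge> 0\<close> by (rule mult_left_mono)
  ultimately show ?thesis by (simp add: mult.commute)
qed

lemma top_right_singular_vectors_orthonormal:
  assumes "B \<in> carrier_mat p q" "top_right_singular_vectors k B W" "k \<le> q"
  shows "orthonormal_cols q k W"
proof -
  obtain U \<sigma> V where svd: "is_svd B U \<sigma> V" and W: "W = mat q k (\<lambda>(i, j). V $$ (i, j))"
    using assms by (auto simp: top_right_singular_vectors_def)
  have V: "orthonormal_cols q q V" using svd assms(1) by (simp add: is_svd_def orthogonal_matrix_iff)
  have "transpose_mat W * W = 1\<^sub>m k"
  proof (rule eq_matI)
    fix i j assume "i < dim_row (1\<^sub>m k)" "j < dim_col (1\<^sub>m k)"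
    then show "(transpose_mat W * W) $$ (i, j) = 1\<^sub>m k $$ (i, j)"
      using orthonormal_cols_sum[OF V, of i j] \<open>k \<le> q\<close>
      by (simp add: W scalar_prod_def lessThan_atLeast0)
  qed (auto simp: W)
  then show ?thesis by (simp add: orthonormal_cols_def W)
qed

text \<open>Ky Fan's maximum principle. The squared row norms of V^T Y lie in [0, 1] and sum to
  \<open>k\<close>, so the \<open>k\<close> largest squared singular values bound the weighted sum;
  for \<open>W\<close> these norms are 1 on the first \<open>k\<close> rows and 0 elsewhere, which
  attains the bound.\<close>

theorem top_right_singular_vectors_maximal:
  assumes B: "B \<in> carrier_mat p q" and W: "top_right_singular_vectors k B W" and k: "1 \<le> k" "k \<le> q"
    and Y: "orthonormal_cols q k Y"
  shows "frob_inner (B * Y) (B * Y) \<le> frob_inner (B * W) (B * W)"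
proof -
  obtain U \<sigma> V where svd: "is_svd B U \<sigma> V" and W_eq: "W = mat q k (\<lambda>(i, j). V $$ (i, j))"
    using assms by (auto simp: top_right_singular_vectors_def)
  have V: "orthogonal_matrix q V" and sorted: "\<And>i j. i \<le> j \<Longrightarrow> j < min p q \<Longrightarrow> \<sigma> j \<le> \<sigma> i"
    and nonneg: "\<And>i. i < min p q \<Longrightarrow> 0 \<le> \<sigma> i"
    using svd by (auto simp: is_svd_iff[OF B])
  have Vc: "V \<in> carrier_mat q q" using V by (simp add: orthogonal_matrix_def)
  \<comment> \<open>The padding by 0 keeps the sequence decreasing up to \<open>q\<close>, also when
    \<open>B\<close> has fewer than \<open>k\<close> rows.\<close>
  define \<tau> where "\<tau> i = (if i < p then (\<sigma> i)\<^sup>2 else 0)" for i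
  define H where "H = transpose_mat V * Y"
  have H: "orthonormal_cols q k H"
    using orthonormal_cols_mult[OF _ Y, of q "transpose_mat V"] orthogonal_matrix_transpose[OF V]
    by (simp add: H_def orthogonal_matrix_iff)
  have "frob_inner (B * Y) (B * Y) = (\<Sum>i<q. \<tau> i * (\<Sum>l<k. (H $$ (i, l))\<^sup>2))"
    using svd_frob[OF B svd orthonormal_cols_carrier[OF Y]] by (simp add: \<tau>_def H_def)
  also have "\<dots> \<le> (\<Sum>i<k. \<tau> i)"
  proof (rule weighted_sum_le_prefix_sum[OF k])
    show "\<tau> j \<le> \<tau> i" if "i \<le> j" "j < q" for i j
      using that sorted[of i j] nonneg[of j] by (auto simp: \<tau>_def intro!: power_mono)
    show "(\<Sum>i<q. \<Sum>l<k. (H $$ (i, l))\<^sup>2) \<le> real k"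
      using frob_inner_orthonormal_cols[OF H] orthonormal_cols_carrier[OF H]
      by (simp add: frob_inner_def power2_eq_square)
  qed (auto simp: \<tau>_def sum_nonneg orthonormal_cols_row_le[OF H])
  also have "\<dots> = (\<Sum>i<q. \<tau> i * (\<Sum>l<k. ((transpose_mat V * W) $$ (i, l))\<^sup>2))"
  proof -
    have "(transpose_mat V * W) $$ (i, l) = (if i = l then 1 else 0)" if "i < q" "l < k" for i l
      using that orthonormal_cols_sum[of q q V i l] V k Vc
      by (simp add: orthogonal_matrix_iff W_eq scalar_prod_def lessThan_atLeast0)
    then have "(\<Sum>i<q. \<tau> i * (\<Sum>l<k. ((transpose_mat V * W) $$ (i, l))\<^sup>2))
        = (\<Sum>i<q. if i \<in> {..<k} then \<tau> i else 0)"
      by (intro sum.cong refl) (simp add: if_distrib[of "\<lambda>x. x\<^sup>2"] cong: if_cong)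
    also have "\<dots> = (\<Sum>i\<in>{..<q} \<inter> {..<k}. \<tau> i)" by (rule sum.inter_restrict[symmetric]) simp
    also have "{..<q} \<inter> {..<k} = {..<k}" using k by auto
    finally show ?thesis by simp
  qed
  also have "\<dots> = frob_inner (B * W) (B * W)"
    using svd_frob[OF B svd, of W k] by (simp add: \<tau>_def W_eq)
  finally show ?thesis .
qed

subsection \<open>Rank\<close>

text \<open>Makes the rank concrete as the size of a maximal independent set of columns, the form
  used for factorizations and for ranks of products.\<close>

lemma maximal_lin_indpt_cols:
  assumes "N \<in> carrier_mat n d"
  obtains S where "maximal S (\<lambda>T. T \<subseteq> set (cols N) \<and>
      module.lin_indpt class_ring (module_vec TYPE(real) n) T)"
    "finite S" "S \<subseteq> set (cols N)" "card S = mat_rank N"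
proof -
  interpret vec_space "TYPE(real)" n .
  obtain S where S: "maximal S (\<lambda>T. T \<subseteq> set (cols N) \<and> lin_indpt T)"
    using maximal_exists[of "(\<lambda>T. T \<subseteq> set (cols N) \<and> lin_indpt T)" "card (set (cols N))" "{}"]
    by (meson List.finite_set card_mono empty_iff empty_subsetI finite_lin_indpt2 rev_finite_subset)
  have sub: "S \<subseteq> set (cols N)" using S by (simp add: maximal_def)
  have "card S = mat_rank N"
    using rank_card_indpt[OF assms S] assms by (simp add: mat_rank_def)
  with S sub show thesis by (intro that) (auto intro: finite_subset)
qed

text \<open>\<open>X\<close> collects a maximal independent set of columns of \<open>N\<close>.
  Every column of \<open>N\<close> lies in their span, and its coefficients form a column of
  \<open>Y\<close>.\<close>

lemma mat_rank_factorization: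
  assumes N: "N \<in> carrier_mat n d"
  obtains X Y where "X \<in> carrier_mat n (mat_rank N)" "Y \<in> carrier_mat (mat_rank N) d" "N = X * Y"
proof -
  interpret vec_space "TYPE(real)" n .
  obtain S where S: "maximal S (\<lambda>T. T \<subseteq> set (cols N) \<and> lin_indpt T)"
    and "finite S" and sub: "S \<subseteq> set (cols N)" and card: "card S = mat_rank N"
    using maximal_lin_indpt_cols[OF N] by blast
  have Sc: "S \<subseteq> carrier_vec n" using sub cols_dim[of N] N by auto
  obtain xs where xs: "set xs = S" "distinct xs" using finite_distinct_list[OF \<open>finite S\<close>] by blast
  then have len: "length xs = mat_rank N" using card distinct_card by fastforce
  define X where "X = mat_of_cols n xs"
  have X: "X \<in> carrier_mat n (mat_rank N)" by (simp add: X_def len[symmetric])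
  have "cols X = xs" unfolding X_def using Sc xs by (intro cols_mat_of_cols) auto
  have "\<exists>y\<in>carrier_vec (mat_rank N). X *\<^sub>v y = col N j" if j: "j < d" for j
  proof -
    have mem: "col N j \<in> set (cols N)" using j N by (auto simp: cols_def)
    have cN: "col N j \<in> carrier_vec n" using N by auto
    have "col N j \<in> span S"
    proof (rule ccontr)
      \<comment> \<open>A column outside the span could be adjoined, against maximality.\<close>
      assume no: "col N j \<notin> span S"
      then have notin: "col N j \<notin> S" using Sc in_own_span[of S] by auto
      have indpt: "lin_indpt S" using S by (simp add: maximal_def)
      have "lin_indpt (S \<union> {col N j})"
        using lin_dep_iff_in_span[of S "col N j"] Sc indpt cN notin no by auto
      moreover have "S \<union> {col N j} \<subseteq> set (cols N)" using sub mem by auto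
      ultimately have "S \<union> {col N j} = S" using S unfolding maximal_def by blast
      then show False using notin by auto
    qed
    then have "col N j \<in> col_space X" by (simp add: col_space_def \<open>cols X = xs\<close> xs)
    then show ?thesis using col_space_eq[OF X] X by auto
  qed
  then obtain y where y: "\<And>j. j < d \<Longrightarrow> y j \<in> carrier_vec (mat_rank N) \<and> X *\<^sub>v y j = col N j"
    by metis
  define Y where "Y = mat (mat_rank N) d (\<lambda>(i, j). y j $ i)"
  have Y: "Y \<in> carrier_mat (mat_rank N) d" by (simp add: Y_def)
  have "N = X * Y"
  proof (rule eq_matI)
    fix i j assume "i < dim_row (X * Y)" "j < dim_col (X * Y)"
    then have ij: "i < n" "j < d" using X Y by auto
    have "col Y j = y j" using y[OF ij(2)] ij by (auto simp: Y_def)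
    then have "(X * Y) $$ (i, j) = (X *\<^sub>v y j) $ i" using ij X Y by simp
    then show "N $$ (i, j) = (X * Y) $$ (i, j)" using y[OF ij(2)] ij N by simp
  qed (use N X Y in auto)
  with X Y show thesis by (rule that)
qed

text \<open>Independent columns of the product lie in the column space of \<open>X\<close>, which at
  most \<open>m\<close> vectors span; Steinitz exchange bounds their number.\<close>

lemma mat_rank_mult_le:
  assumes X: "X \<in> carrier_mat n m" and Y: "Y \<in> carrier_mat m d"
  shows "mat_rank (X * Y) \<le> m"
proof -
  interpret vec_space "TYPE(real)" n .
  have XY: "X * Y \<in> carrier_mat n d" using X Y by simp
  obtain S where S: "maximal S (\<lambda>T. T \<subseteq> set (cols (X * Y)) \<and> lin_indpt T)"
    and fin: "finite S" and sub: "S \<subseteq> set (cols (X * Y))" and card: "card S = mat_rank (X * Y)"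
    using maximal_lin_indpt_cols[OF XY] by blast
  have "S \<subseteq> col_space X"
  proof
    fix v assume "v \<in> S"
    then obtain j where j: "j < d" "v = col (X * Y) j" using sub X Y by (auto simp: cols_def)
    then have "v = X *\<^sub>v col Y j" using X Y by (auto intro!: eq_vecI)
    moreover have "col Y j \<in> carrier_vec m" using Y by auto
    ultimately show "v \<in> col_space X" using col_space_eq[OF X] X by auto
  qed
  then have "S \<subseteq> span (set (cols X))" by (simp add: col_space_def)
  moreover have "lin_indpt S" using S by (simp add: maximal_def)
  moreover have "set (cols X) \<subseteq> carrier_vec n" using cols_dim[of X] X by auto
  ultimately have "card S \<le> card (set (cols X))"
    using replacement[of S "set (cols X)"] fin by auto
  also have "\<dots> \<le> m" using card_length[of "cols X"] X by simp
  finally show ?thesis by (simp add: card)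
qed

lemma mat_rank_le_dim_col:
  assumes "N \<in> carrier_mat n d"
  shows "mat_rank N \<le> d"
  using mat_rank_mult_le[OF assms one_carrier_mat] assms by simp

section \<open>Low-rank matrices and orthogonal projections\<close>

text \<open>Factor \<open>N\<close> through a matrix \<open>Z\<close> with as many rows as the rank
  of \<open>N\<close>. A singular value decomposition of \<open>Z\<close> puts its row space into
  the span of the first \<open>m\<close> columns of \<open>V\<close>; taking the first
  \<open>k\<close> >= \<open>m\<close> of them gives \<open>Y\<close>.\<close>

lemma low_rank_right_projection:
  assumes N: "N \<in> carrier_mat n d" and k: "mat_rank N \<le> k" "k \<le> d"
  obtains Y where "orthonormal_cols d k Y" "N * (Y * transpose_mat Y) = N"
proof -
  define m where "m = mat_rank N"
  obtain X Z where X: "X \<in> carrier_mat n m" and Z: "Z \<in> carrier_mat m d" and N_eq: "N = X * Z"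
    using mat_rank_factorization[OF N] unfolding m_def by blast
  obtain U \<sigma> V where svd: "is_svd Z U \<sigma> V" using svd_exists[OF Z] by blast
  have U: "orthogonal_matrix m U" and V: "orthogonal_matrix d V"
    and Z_eq: "Z = U * rect_diag m d \<sigma> * transpose_mat V"
    using svd by (auto simp: is_svd_iff[OF Z])
  have Uc: "U \<in> carrier_mat m m" and Vc: "V \<in> carrier_mat d d" and VV: "transpose_mat V * V = 1\<^sub>m d"
    using U V by (auto simp: orthogonal_matrix_def)
  have mk: "m \<le> k" using k(1) by (simp add: m_def)
  let ?J = "rect_diag d k (\<lambda>_. 1)"
  let ?D = "rect_diag m d \<sigma>"
  have J: "orthonormal_cols d k ?J"
    using k(2) unfolding orthonormal_cols_def
    by (auto intro!: eq_matI simp: scalar_prod_def rect_diag_def if_distrib[of "\<lambda>x. x * _"] cong: if_cong)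
  define E where "E = ?J * transpose_mat ?J"
  have E: "E \<in> carrier_mat d d" by (simp add: E_def mult_carrier_mat[of _ d k _ d])
  have E_nth: "E $$ (a, b) = (if a = b \<and> a < k then 1 else 0)" if "a < d" "b < d" for a b
    using that by (simp add: E_def scalar_prod_def rect_diag_def if_distrib[of "\<lambda>x. x * _"] cong: if_cong)
  \<comment> \<open>\<open>E\<close> is the coordinate projection onto the first \<open>k\<close>
    coordinates, and \<open>?D\<close> has nonzero entries only in columns below m <= k.\<close>
  have DE: "?D * E = ?D"
  proof (rule eq_matI)
    fix a b assume "a < dim_row ?D" "b < dim_col ?D"
    then have ab: "a < m" "b < d" by auto
    then have "(?D * E) $$ (a, b) = \<sigma> a * E $$ (a, b)"
      using E k(2) mk by (simp add: scalar_prod_def rect_diag_def if_distrib[of "\<lambda>x. x * _"] cong: if_cong)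
    then show "(?D * E) $$ (a, b) = ?D $$ (a, b)"
      using ab mk k(2) by (auto simp: E_nth rect_diag_def)
  qed (use E in auto)
  define Y where "Y = V * ?J"
  have Y: "orthonormal_cols d k Y"
    using orthonormal_cols_mult[OF _ J, of d V] V by (simp add: Y_def orthogonal_matrix_iff)
  have "Y * transpose_mat Y = V * (E * transpose_mat V)"
    unfolding Y_def E_def using Vc
    by (simp add: transpose_mult[of _ d d _ k] assoc_mult_mat[of _ d d _ k _ d]
        assoc_mult_mat[of _ d k _ d _ d] mult_carrier_mat[of _ k d _ d])
  then have "N * (Y * transpose_mat Y) = X * (U * (?D * ((transpose_mat V * V) * (E * transpose_mat V))))"
    unfolding N_eq Z_eq using X Uc Vc E
    by (simp add: assoc_mult_mat[of _ n m _ d _ d] assoc_mult_mat[of _ m m _ d _ d]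
        assoc_mult_mat[of _ m d _ d _ d] assoc_mult_mat[of _ d d _ d _ d]
        mult_carrier_mat[of _ m m _ d] mult_carrier_mat[of _ m d _ d] mult_carrier_mat[of _ d d _ d])
  also have "?D * ((transpose_mat V * V) * (E * transpose_mat V)) = (?D * E) * transpose_mat V"
    unfolding VV using Vc E
    by (simp add: assoc_mult_mat[of _ m d _ d _ d] left_mult_one_mat[of _ d d] mult_carrier_mat[of _ d d _ d])
  also have "X * (U * ((?D * E) * transpose_mat V)) = N"
    unfolding DE N_eq Z_eq using Uc Vc by (simp add: assoc_mult_mat[of _ m m _ d _ d])
  finally show thesis using Y by (intro that)
qed

text \<open>The projection for \<open>N\<close> leaves \<open>N\<close> fixed, so \<open>A\<close>
  and A - N have the same residual, and by Pythagoras the residual of A - N is no larger than A -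
  N.\<close>

lemma frob_low_rank_ge:
  assumes A: "A \<in> carrier_mat n d" and N: "N \<in> carrier_mat n d" and k: "mat_rank N \<le> k" "k \<le> d"
  obtains Y where "orthonormal_cols d k Y"
    "frob_inner A A - frob_inner (A * Y) (A * Y) \<le> frob_inner (A - N) (A - N)"
proof -
  obtain Y where Y: "orthonormal_cols d k Y" and NY: "N * (Y * transpose_mat Y) = N"
    using low_rank_right_projection[OF N k] by blast
  have Yc: "Y \<in> carrier_mat d k" using Y by (rule orthonormal_cols_carrier)
  let ?P = "Y * transpose_mat Y"
  have P: "?P \<in> carrier_mat d d" using Yc by simp
  have "(A - N) - (A - N) * ?P = A - A * ?P"
  proof -
    have "(A - N) * ?P = A * ?P - N" using minus_mult_distrib_mat[OF A N P] NY by simp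
    then show ?thesis using A N mult_carrier_mat[OF A P] by (auto intro!: eq_matI)
  qed
  then have "frob_inner A A - frob_inner (A * Y) (A * Y)
      = frob_inner (A - N) (A - N) - frob_inner ((A - N) * Y) ((A - N) * Y)"
    using frob_residual[OF A Y] frob_residual[OF minus_carrier_mat[OF N] Y, of A] by simp
  then show thesis using that[OF Y] frob_inner_nonneg[of "(A - N) * Y"] by simp
qed

lemma projection_matrix_orthonormal_cols:
  assumes "orthonormal_cols d k W"
  shows "projection_matrix d (W * transpose_mat W)"
proof -
  have W: "W \<in> carrier_mat d k" "transpose_mat W * W = 1\<^sub>m k"
    using assms by (auto simp: orthonormal_cols_def)
  have "W * transpose_mat W * (W * transpose_mat W) = W * ((transpose_mat W * W) * transpose_mat W)"
    using W(1) by (simp add: assoc_mult_mat[of _ d k _ d _ d] assoc_mult_mat[of _ k d _ k _ d]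
        mult_carrier_mat[of _ d k _ d] mult_carrier_mat[of _ k d _ d])
  then show ?thesis
    using W by (simp add: projection_matrix_def transpose_mult[of _ d k _ d] left_mult_one_mat[of _ k d])
qed

text \<open>Restricted to the row space of \<open>P = W W\<^sup>T\<close>, spanned by \<open>rank P\<close> orthonormal vectors, \<open>P\<close> keeps
  its squared Frobenius norm \<open>k\<close>, which is at most the number of these vectors.\<close>

lemma mat_rank_orthonormal_cols:
  assumes W: "orthonormal_cols d k W"
  shows "mat_rank (W * transpose_mat W) = k"
proof (rule antisym)
  have Wc: "W \<in> carrier_mat d k" and WW: "transpose_mat W * W = 1\<^sub>m k"
    using W by (auto simp: orthonormal_cols_def)
  let ?P = "W * transpose_mat W"
  let ?m = "mat_rank ?P"
  have P: "?P \<in> carrier_mat d d" using Wc by simp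
  have PW: "?P * W = W"
    using Wc WW by (simp add: assoc_mult_mat[of _ d k _ d _ k])
  show "?m \<le> k" using mat_rank_mult_le[OF Wc, of "transpose_mat W" d] Wc by simp
  have "?m \<le> d" by (rule mat_rank_le_dim_col[OF P])
  then obtain Y where Y: "orthonormal_cols d ?m Y" and PY: "?P * (Y * transpose_mat Y) = ?P"
    using low_rank_right_projection[OF P order_refl] by blast
  have Yc: "Y \<in> carrier_mat d ?m" using Y by (rule orthonormal_cols_carrier)
  \<comment> \<open>W^T is recovered as W^T P, so a right projection that fixes \<open>P\<close>
    fixes W^T as well.\<close>
  have T: "transpose_mat W * (Y * transpose_mat Y) = transpose_mat W"
  proof -
    have "transpose_mat W * ?P = transpose_mat W"
      using Wc WW by (simp add: assoc_mult_mat[of _ k d _ k _ d, symmetric])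
    moreover have "transpose_mat W * (?P * (Y * transpose_mat Y)) = (transpose_mat W * ?P) * (Y * transpose_mat Y)"
      using Wc Yc P by (intro assoc_mult_mat[symmetric]) auto
    ultimately show ?thesis by (simp add: PY)
  qed
  have Wt: "transpose_mat W \<in> carrier_mat k d" using Wc by simp
  have "frob_inner (transpose_mat W - transpose_mat W * (Y * transpose_mat Y))
      (transpose_mat W - transpose_mat W * (Y * transpose_mat Y)) = 0"
    unfolding T using Wc by (simp add: frob_inner_def)
  then have "real k = frob_inner (transpose_mat W * Y) (transpose_mat W * Y)"
    using frob_residual[OF Wt Y] frob_inner_transpose[OF Wc Wc] frob_inner_orthonormal_cols[OF W] by simp
  also have "\<dots> = frob_inner (transpose_mat Y * W) (transpose_mat Y * W)"
    using frob_inner_transpose[of "transpose_mat Y * W" ?m k "transpose_mat Y * W"] Wc Yc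
    by (simp add: transpose_mult[of _ ?m d _ k])
  also have "\<dots> \<le> frob_inner (transpose_mat Y) (transpose_mat Y)"
    using Yc by (intro frob_mult_orthonormal_le[OF _ W]) auto
  also have "\<dots> = real ?m" using frob_inner_transpose[OF Yc Yc] frob_inner_orthonormal_cols[OF Y] by simp
  finally show "k \<le> ?m" by simp
qed

section \<open>Gram matrices and the deterministic error bound\<close>

text \<open>The squared Frobenius distance of A^T A and B^T B, written entrywise since expectations
  are taken entry by entry later.\<close>

definition gram_dist_sq :: "nat \<Rightarrow> real mat \<Rightarrow> real mat \<Rightarrow> real" where
  "gram_dist_sq d A B = (\<Sum>a<d. \<Sum>b<d.
     ((\<Sum>i<dim_row A. A $$ (i, a) * A $$ (i, b)) - (\<Sum>i<dim_row B. B $$ (i, a) * B $$ (i, b)))\<^sup>2)"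

text \<open>The left side depends on \<open>A\<close> only through its Gram matrix, so matrices with
  different numbers of rows become comparable.\<close>

lemma frob_mult_eq_gram:
  assumes A: "A \<in> carrier_mat n d" and W: "W \<in> carrier_mat d k"
  shows "frob_inner (A * W) (A * W)
    = (\<Sum>l<k. \<Sum>a<d. \<Sum>b<d. W $$ (a, l) * W $$ (b, l) * (\<Sum>i<n. A $$ (i, a) * A $$ (i, b)))"
proof -
  have "frob_inner (A * W) (A * W)
    = (\<Sum>i<n. \<Sum>l<k. \<Sum>a<d. \<Sum>b<d. W $$ (a, l) * W $$ (b, l) * (A $$ (i, a) * A $$ (i, b)))"
    using A W by (simp add: frob_inner_def scalar_prod_def lessThan_atLeast0 sum_product mult_ac)
  also have "\<dots> = (\<Sum>l<k. \<Sum>a<d. \<Sum>b<d. \<Sum>i<n. W $$ (a, l) * W $$ (b, l) * (A $$ (i, a) * A $$ (i, b)))"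
    by (subst sum.swap, rule sum.cong[OF refl], subst sum.swap, rule sum.cong[OF refl], subst sum.swap, rule refl)
  finally show ?thesis by (simp add: sum_distrib_left)
qed

text \<open>Cauchy-Schwarz over index pairs: the rank-one matrix w w^T has Frobenius norm 1.\<close>

lemma quadratic_form_le:
  fixes M :: "nat \<Rightarrow> nat \<Rightarrow> real"
  assumes "(\<Sum>a<d. (w a)\<^sup>2) = 1"
  shows "\<bar>\<Sum>a<d. \<Sum>b<d. w a * w b * M a b\<bar> \<le> sqrt (\<Sum>a<d. \<Sum>b<d. (M a b)\<^sup>2)"
proof -
  let ?I = "{..<d} \<times> {..<d}"
  have "(\<Sum>z\<in>?I. (w (fst z) * w (snd z)) * M (fst z) (snd z))\<^sup>2
      \<le> (\<Sum>z\<in>?I. (w (fst z) * w (snd z))\<^sup>2) * (\<Sum>z\<in>?I. (M (fst z) (snd z))\<^sup>2)"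
    by (rule Cauchy_Schwarz_ineq_sum)
  also have "(\<Sum>z\<in>?I. (w (fst z) * w (snd z))\<^sup>2) = (\<Sum>a<d. (w a)\<^sup>2) * (\<Sum>a<d. (w a)\<^sup>2)"
    by (simp add: sum_product sum.cartesian_product power_mult_distrib case_prod_beta)
  finally have "(\<Sum>a<d. \<Sum>b<d. w a * w b * M a b)\<^sup>2 \<le> (\<Sum>a<d. \<Sum>b<d. (M a b)\<^sup>2)"
    by (simp add: assms sum.cartesian_product case_prod_beta)
  then show ?thesis using real_le_rsqrt[of "\<bar>_\<bar>"] by (simp add: real_le_rsqrt)
qed

text \<open>Each column \<open>w\<close> of \<open>W\<close> contributes \<open>w\<^sup>T (A\<^sup>T A - B\<^sup>T B) w\<close>, and a unit vector gives at
  most the Frobenius norm of the difference of the Gram matrices.\<close>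

lemma frob_mult_gram_diff:
  assumes A: "A \<in> carrier_mat n d" and B: "B \<in> carrier_mat r d" and W: "orthonormal_cols d k W"
  shows "\<bar>frob_inner (A * W) (A * W) - frob_inner (B * W) (B * W)\<bar> \<le> real k * sqrt (gram_dist_sq d A B)"
proof -
  have Wc: "W \<in> carrier_mat d k" using W by (rule orthonormal_cols_carrier)
  define M where "M a b = (\<Sum>i<n. A $$ (i, a) * A $$ (i, b)) - (\<Sum>i<r. B $$ (i, a) * B $$ (i, b))" for a b
  have M: "gram_dist_sq d A B = (\<Sum>a<d. \<Sum>b<d. (M a b)\<^sup>2)"
    using A B by (simp add: gram_dist_sq_def M_def)
  have "frob_inner (A * W) (A * W) - frob_inner (B * W) (B * W)
      = (\<Sum>l<k. \<Sum>a<d. \<Sum>b<d. W $$ (a, l) * W $$ (b, l) * M a b)"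
    unfolding frob_mult_eq_gram[OF A Wc] frob_mult_eq_gram[OF B Wc] M_def
    by (simp add: right_diff_distrib sum_subtractf)
  also have "\<bar>\<dots>\<bar> \<le> (\<Sum>l<k. \<bar>\<Sum>a<d. \<Sum>b<d. W $$ (a, l) * W $$ (b, l) * M a b\<bar>)"
    by (rule sum_abs)
  also have "\<dots> \<le> (\<Sum>l<k. sqrt (gram_dist_sq d A B))"
    unfolding M by (intro sum_mono quadratic_form_le)
      (use orthonormal_cols_sum[OF W] in \<open>simp add: power2_eq_square\<close>)
  finally show ?thesis by simp
qed

text \<open>Compare \<open>W\<close> with the projection \<open>Y\<close> that does at least as well
  as \<open>N\<close>. Pass from \<open>A\<close> to \<open>B\<close> for \<open>Y\<close>, use
  optimality of \<open>W\<close> for \<open>B\<close>, and pass back to \<open>A\<close> for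
  \<open>W\<close>; the two passages account for the factor 2.\<close>

theorem sampled_projection_error:
  assumes A: "A \<in> carrier_mat n d" and B: "B \<in> carrier_mat r d"
    and W: "top_right_singular_vectors k B W" and k: "1 \<le> k" "k \<le> d"
    and N: "N \<in> carrier_mat n d" "mat_rank N \<le> k"
  shows "(frobenius_norm (A - A * (W * transpose_mat W)))\<^sup>2
    \<le> (frobenius_norm (A - N))\<^sup>2 + 2 * real k * sqrt (gram_dist_sq d A B)"
proof -
  have Wo: "orthonormal_cols d k W" by (rule top_right_singular_vectors_orthonormal[OF B W k(2)])
  obtain Y where Y: "orthonormal_cols d k Y"
    "frob_inner A A - frob_inner (A * Y) (A * Y) \<le> frob_inner (A - N) (A - N)"
    using frob_low_rank_ge[OF A N k(2)] by blast
  show ?thesis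
    unfolding frobenius_norm_sq frob_residual[OF A Wo]
    using Y(2) frob_mult_gram_diff[OF A B Wo] frob_mult_gram_diff[OF A B Y(1)]
      top_right_singular_vectors_maximal[OF B W k Y(1)] by linarith
qed

subsection \<open>Concentration of the Gram matrix\<close>

text \<open>The variance of an average. Expanding the square of the centred sum, independence
  removes the off-diagonal terms, and each of the \<open>r\<close> diagonal terms is a variance,
  hence at most the second moment.\<close>

lemma (in prob_space) iid_mean_square_error:
  fixes Z :: "nat \<Rightarrow> 'a \<Rightarrow> real"
  assumes indep: "indep_vars (\<lambda>_. borel) Z {..<r}" and "0 < r"
    and sq: "\<And>j. j < r \<Longrightarrow> integrable M (\<lambda>\<omega>. (Z j \<omega>)\<^sup>2)"
    and mean: "\<And>j. j < r \<Longrightarrow> expectation (Z j) = \<mu>"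
    and second: "\<And>j. j < r \<Longrightarrow> expectation (\<lambda>\<omega>. (Z j \<omega>)\<^sup>2) \<le> v"
  shows "integrable M (\<lambda>\<omega>. ((\<Sum>j<r. Z j \<omega>) / real r - \<mu>)\<^sup>2)"
    and "expectation (\<lambda>\<omega>. ((\<Sum>j<r. Z j \<omega>) / real r - \<mu>)\<^sup>2) \<le> v / real r"
proof -
  define Y where "Y j \<omega> = Z j \<omega> - \<mu>" for j \<omega>
  have Zm [measurable]: "Z j \<in> borel_measurable M" if "j < r" for j
    using indep that by (auto simp: indep_vars_def)
  have Zi: "integrable M (Z j)" if "j < r" for j
    using square_integrable_imp_integrable[OF Zm sq] that by blast
  have Yi: "integrable M (Y j)" and Y0: "expectation (Y j) = 0" if "j < r" for j
    using Zi[OF that] mean[OF that] by (simp_all add: Y_def[abs_def] prob_space)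
  have indep_Y: "indep_vars (\<lambda>_. borel) Y {..<r}"
    using indep_vars_compose2[OF indep, of "\<lambda>_ x. x - \<mu>" "\<lambda>_. borel"] by (simp add: Y_def[abs_def])
  have YY: "integrable M (\<lambda>\<omega>. Y j \<omega> * Y l \<omega>) \<and>
      expectation (\<lambda>\<omega>. Y j \<omega> * Y l \<omega>) \<le> (if j = l then v else 0)" if "j < r" "l < r" for j l
  proof (cases "j = l")
    case True
    have eq: "(\<lambda>\<omega>. Y j \<omega> * Y l \<omega>) = (\<lambda>\<omega>. (Z j \<omega>)\<^sup>2 - 2 * \<mu> * Z j \<omega> + \<mu>\<^sup>2)"
      using True by (auto simp: Y_def power2_eq_square algebra_simps)
    have "expectation (\<lambda>\<omega>. (Z j \<omega>)\<^sup>2 - 2 * \<mu> * Z j \<omega> + \<mu>\<^sup>2)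
        = expectation (\<lambda>\<omega>. (Z j \<omega>)\<^sup>2) - 2 * \<mu> * \<mu> + \<mu>\<^sup>2"
      using sq[OF that(1)] Zi[OF that(1)] mean[OF that(1)] by (simp add: prob_space)
    also have "\<dots> \<le> v" using second[OF that(1)] by (simp add: power2_eq_square) (smt (verit) zero_le_square)
    finally show ?thesis
      unfolding eq using True sq[OF that(1)] Zi[OF that(1)] by simp
  next
    case False
    have ind: "indep_vars (\<lambda>_. borel) Y {j, l}"
      by (rule indep_vars_subset[OF indep_Y]) (use that in auto)
    have "integrable M (\<lambda>\<omega>. \<Prod>i\<in>{j, l}. Y i \<omega>)"
      by (rule indep_vars_integrable[OF _ ind]) (use Yi that in auto)
    moreover have "expectation (\<lambda>\<omega>. \<Prod>i\<in>{j, l}. Y i \<omega>) = (\<Prod>i\<in>{j, l}. expectation (Y i))"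
      by (rule indep_vars_lebesgue_integral[OF _ ind]) (use Yi that in auto)
    ultimately show ?thesis using False Y0 that by simp
  qed
  have eq: "(\<lambda>\<omega>. ((\<Sum>j<r. Z j \<omega>) / real r - \<mu>)\<^sup>2)
      = (\<lambda>\<omega>. (\<Sum>j<r. \<Sum>l<r. Y j \<omega> * Y l \<omega>) / (real r)\<^sup>2)"
  proof
    fix \<omega>
    have "(\<Sum>j<r. Z j \<omega>) / real r - \<mu> = (\<Sum>j<r. Y j \<omega>) / real r"
      using \<open>0 < r\<close> by (simp add: Y_def sum_subtractf field_simps)
    then show "((\<Sum>j<r. Z j \<omega>) / real r - \<mu>)\<^sup>2 = (\<Sum>j<r. \<Sum>l<r. Y j \<omega> * Y l \<omega>) / (real r)\<^sup>2"
      by (simp add: power_divide) (simp add: power2_eq_square sum_product)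
  qed
  show "integrable M (\<lambda>\<omega>. ((\<Sum>j<r. Z j \<omega>) / real r - \<mu>)\<^sup>2)"
    unfolding eq using YY by (intro integrable_divide Bochner_Integration.integrable_sum) auto
  have "expectation (\<lambda>\<omega>. (\<Sum>j<r. \<Sum>l<r. Y j \<omega> * Y l \<omega>))
      = (\<Sum>j<r. expectation (\<lambda>\<omega>. \<Sum>l<r. Y j \<omega> * Y l \<omega>))"
    using YY by (intro Bochner_Integration.integral_sum Bochner_Integration.integrable_sum) auto
  also have "\<dots> = (\<Sum>j<r. \<Sum>l<r. expectation (\<lambda>\<omega>. Y j \<omega> * Y l \<omega>))"
    using YY by (intro sum.cong refl Bochner_Integration.integral_sum) auto
  also have "\<dots> \<le> (\<Sum>j<r. \<Sum>l<r. if j = l then v else 0)"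
    using YY by (intro sum_mono) auto
  also have "\<dots> = real r * v" by simp
  finally show "expectation (\<lambda>\<omega>. ((\<Sum>j<r. Z j \<omega>) / real r - \<mu>)\<^sup>2) \<le> v / real r"
    unfolding eq using \<open>0 < r\<close> by (simp add: field_simps power2_eq_square)
qed

section \<open>Integrals and almost sure properties of the sampler\<close>

lemma sampler_simps:
  assumes "sampler c \<gamma> A D"
  shows "prob_space D" "space D = UNIV" "\<And>i. {i} \<times> UNIV \<in> sets D"
    "(\<Sum>i<dim_row A. row_prob D i) = 1" "0 \<le> row_prob D i"
    "i < dim_row A \<Longrightarrow> c * (\<Sum>j<dim_col A. (A $$ (i, j))\<^sup>2) \<le> row_prob D i * (frobenius_norm A)\<^sup>2"
proof -
  have sets: "sets D = sets (count_space UNIV \<Otimes>\<^sub>M borel)" using assms by (simp add: sampler_def)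
  show "prob_space D" "(\<Sum>i<dim_row A. row_prob D i) = 1" using assms by (simp_all add: sampler_def)
  show "space D = UNIV" using sets_eq_imp_space_eq[OF sets] by (simp add: space_pair_measure)
  show "{i} \<times> UNIV \<in> sets D" for i
    unfolding sets by (intro pair_measureI) auto
  show "0 \<le> row_prob D i" by (simp add: row_prob_def)
  show "c * (\<Sum>j<dim_col A. (A $$ (i, j))\<^sup>2) \<le> row_prob D i * (frobenius_norm A)\<^sup>2"
    if i: "i < dim_row A"
  proof (cases "frobenius_norm A = 0")
    case True
    then have "(\<Sum>i<dim_row A. \<Sum>j<dim_col A. (A $$ (i, j))\<^sup>2) = 0"
      by (simp add: frobenius_norm_def)
    then have "(\<Sum>j<dim_col A. (A $$ (i, j))\<^sup>2) = 0"
      using i by (subst (asm) sum_nonneg_eq_0_iff) (auto simp: sum_nonneg)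
    then show ?thesis using True by simp
  next
    case False
    have "c * (\<Sum>j<dim_col A. (A $$ (i, j))\<^sup>2) / (frobenius_norm A)\<^sup>2 \<le> row_prob D i"
      using assms i by (simp add: sampler_def vec_norm2_def sum_nonneg)
    then show ?thesis using False by (simp add: pos_divide_le_eq)
  qed
qed

text \<open>Such an integrand is a finite combination of indicators of the sets {i} x UNIV, so only
  the row probabilities enter, however the reported number is distributed.\<close>

lemma sampler_integral_row:
  fixes h :: "nat \<Rightarrow> real"
  assumes D: "sampler c \<gamma> A D" and h: "\<And>i. dim_row A \<le> i \<Longrightarrow> h i = 0"
  shows "integrable D (\<lambda>x. h (fst x))"
    and "(\<integral>x. h (fst x) \<partial>D) = (\<Sum>i<dim_row A. row_prob D i * h i)"
proof -
  interpret D: prob_space D using sampler_simps(1)[OF D] .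
  have eq: "(\<lambda>x :: nat \<times> real. h (fst x)) = (\<lambda>x. \<Sum>i<dim_row A. h i * indicat_real ({i} \<times> UNIV) x)"
  proof
    fix x :: "nat \<times> real"
    have "(\<Sum>i<dim_row A. h i * indicat_real ({i} \<times> UNIV) x) = (\<Sum>i<dim_row A. if fst x = i then h i else 0)"
      by (intro sum.cong) (auto simp: indicator_def mem_Times_iff)
    then show "h (fst x) = (\<Sum>i<dim_row A. h i * indicat_real ({i} \<times> UNIV) x)"
      using h by simp
  qed
  have int: "integrable D (\<lambda>x. h i * indicat_real ({i} \<times> UNIV) x)" for i
    using sampler_simps(3)[OF D, of i] by (intro integrable_mult_right integrable_real_indicator)
      (auto simp: D.emeasure_finite less_top[symmetric])
  show "integrable D (\<lambda>x. h (fst x))" unfolding eq using int by (intro Bochner_Integration.integrable_sum)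
  show "(\<integral>x. h (fst x) \<partial>D) = (\<Sum>i<dim_row A. row_prob D i * h i)"
  proof -
    have "(\<integral>x. h (fst x) \<partial>D) = (\<Sum>i<dim_row A. \<integral>x. h i * indicat_real ({i} \<times> UNIV) x \<partial>D)"
      unfolding eq by (rule Bochner_Integration.integral_sum) (rule int)
    also have "\<dots> = (\<Sum>i<dim_row A. row_prob D i * h i)"
      using sampler_simps(2)[OF D] by (simp add: row_prob_def mult.commute)
    finally show ?thesis .
  qed
qed

text \<open>The row probabilities sum to 1, so the indicator \<open>h\<close> of valid rows with
  positive probability has integral 1; being at most 1, it equals 1 almost everywhere.\<close>

lemma sampler_AE:
  assumes D: "sampler c \<gamma> A D"
  shows "AE x in D. fst x < dim_row A \<and> 0 < row_prob D (fst x) \<and>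
    (1 - \<gamma>) * row_prob D (fst x) \<le> snd x \<and> snd x \<le> (1 + \<gamma>) * row_prob D (fst x)"
proof -
  interpret D: prob_space D using sampler_simps(1)[OF D] .
  define h where "h i = (if i < dim_row A \<and> 0 < row_prob D i then 1 else 0 :: real)" for i
  have int: "integrable D (\<lambda>x. h (fst x))"
    using sampler_integral_row(1)[OF D, of h] by (simp add: h_def)
  have "(\<integral>x. h (fst x) \<partial>D) = (\<Sum>i<dim_row A. row_prob D i * h i)"
    using sampler_integral_row(2)[OF D, of h] by (simp add: h_def)
  also have "\<dots> = (\<Sum>i<dim_row A. row_prob D i)"
    using sampler_simps(5)[OF D] by (intro sum.cong) (auto simp: h_def less_le)
  finally have "(\<integral>x. h (fst x) \<partial>D) = (\<integral>x. 1 \<partial>D)"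
    using sampler_simps(4)[OF D] by (simp add: D.prob_space)
  then have "AE x in D. h (fst x) = 1"
    by (intro integral_ineq_eq_0_then_AE int) (auto simp: h_def)
  moreover have "AE x in D. (1 - \<gamma>) * row_prob D (fst x) \<le> snd x \<and> snd x \<le> (1 + \<gamma>) * row_prob D (fst x)"
    using D by (simp add: sampler_def case_prod_beta)
  ultimately show ?thesis by eventually_elim (auto simp: h_def split: if_splits)
qed

text \<open>Replacing the exact row probabilities \<open>Q\<close> by the estimates \<open>q\<close> multiplies the contribution of
  each sampled row by \<open>Q / q\<close>, which is within \<open>2 \<gamma>\<close> of \<open>1\<close>.\<close>

lemma gram_dist_sq_estimates:
  fixes Q :: "nat \<Rightarrow> real"
  assumes A: "A \<in> carrier_mat n d" and r: "0 < r" and c: "0 < c" and \<gamma>: "0 \<le> \<gamma>" "\<gamma> \<le> 1/2"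
    and row: "\<And>i. i < n \<Longrightarrow> c * (\<Sum>j<d. (A $$ (i, j))\<^sup>2) \<le> Q i * F"
    and good: "\<And>j. j < r \<Longrightarrow> idx j < n \<and> 0 < Q (idx j) \<and>
      (1 - \<gamma>) * Q (idx j) \<le> q j \<and> q j \<le> (1 + \<gamma>) * Q (idx j)"
  shows "gram_dist_sq d A (mat r d (\<lambda>(j, l). A $$ (idx j, l) / sqrt (real r * q j)))
    \<le> 2 * (\<Sum>a<d. \<Sum>b<d. ((\<Sum>j<r. A $$ (idx j, a) * A $$ (idx j, b) / Q (idx j)) / real r
          - (\<Sum>i<n. A $$ (i, a) * A $$ (i, b)))\<^sup>2)
      + 8 * \<gamma>\<^sup>2 * (F / c)\<^sup>2"
proof -
  let ?B = "mat r d (\<lambda>(j, l). A $$ (idx j, l) / sqrt (real r * q j))"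
  define h where "h a b j = A $$ (idx j, a) * A $$ (idx j, b) / Q (idx j)" for a b j
  define e where "e j = Q (idx j) / q j - 1" for j
  define S where "S a b = (\<Sum>i<n. A $$ (i, a) * A $$ (i, b))" for a b
  have q: "0 < q j" "\<bar>e j\<bar> \<le> 2 * \<gamma>" if "j < r" for j
  proof -
    have Q: "0 < Q (idx j)" "(1 - \<gamma>) * Q (idx j) \<le> q j" "q j \<le> (1 + \<gamma>) * Q (idx j)"
      using good[OF that] by auto
    \<comment> \<open>Here \<open>\<gamma>\<close> <= 1/2 enters: it gives Q <= 2 q, so an error of
      \<open>\<gamma>\<close> relative to \<open>Q\<close> is at most \<open>2 * \<gamma>\<close>
      relative to \<open>q\<close>.\<close>
    have half: "1/2 * Q (idx j) \<le> (1 - \<gamma>) * Q (idx j)"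
      using Q(1) \<gamma> by (intro mult_right_mono) auto
    then have le2: "Q (idx j) \<le> 2 * q j" using Q by linarith
    then show "0 < q j" using Q by linarith
    have "\<bar>Q (idx j) - q j\<bar> \<le> \<gamma> * Q (idx j)"
      using Q by (simp add: algebra_simps abs_le_iff)
    also have "\<dots> \<le> \<gamma> * (2 * q j)" using le2 \<gamma> by (intro mult_left_mono) auto
    finally show "\<bar>e j\<bar> \<le> 2 * \<gamma>"
      using \<open>0 < q j\<close> by (simp add: e_def abs_le_iff field_simps)
  qed
  have B: "(\<Sum>j<r. ?B $$ (j, a) * ?B $$ (j, b)) = (\<Sum>j<r. h a b j) / real r + (\<Sum>j<r. h a b j * e j) / real r"
    if "a < d" "b < d" for a b
  proof -
    have "?B $$ (j, a) * ?B $$ (j, b) = h a b j / real r + h a b j * e j / real r" if j: "j < r" for j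
    proof -
      have "?B $$ (j, a) * ?B $$ (j, b) = A $$ (idx j, a) * A $$ (idx j, b) / (sqrt (real r * q j) * sqrt (real r * q j))"
        using j \<open>a < d\<close> \<open>b < d\<close> by simp
      also have "sqrt (real r * q j) * sqrt (real r * q j) = real r * q j"
        using q[OF j] by simp
      also have "A $$ (idx j, a) * A $$ (idx j, b) / (real r * q j) = h a b j / real r + h a b j * e j / real r"
        using q[OF j] good[OF j] r by (simp add: h_def e_def field_simps)
      finally show ?thesis .
    qed
    then show ?thesis by (simp add: sum.distrib sum_divide_distrib)
  qed
  \<comment> \<open>Each estimator is the outer product of a row with itself divided by
    \<open>Q\<close>; its Frobenius norm is the squared row norm over \<open>Q\<close>, which the
    sampler bound limits to F / c.\<close>
  have row_le: "(\<Sum>a<d. \<Sum>b<d. (h a b j)\<^sup>2) \<le> (F / c)\<^sup>2" if j: "j < r" for j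
  proof -
    define R where "R = (\<Sum>l<d. (A $$ (idx j, l))\<^sup>2)"
    have Q: "0 < Q (idx j)" "idx j < n" using good[OF j] by auto
    have "(\<Sum>a<d. \<Sum>b<d. (h a b j)\<^sup>2) = (R / Q (idx j))\<^sup>2"
      by (simp add: h_def R_def power_divide power_mult_distrib sum_divide_distrib[symmetric])
        (simp add: power2_eq_square sum_product)
    also have "R / Q (idx j) \<le> F / c"
      using row[OF Q(2)] Q c by (simp add: R_def field_simps)
    then have "(R / Q (idx j))\<^sup>2 \<le> (F / c)\<^sup>2"
      using Q by (intro power_mono) (auto simp: R_def sum_nonneg)
    finally show ?thesis .
  qed
  have err: "(\<Sum>a<d. \<Sum>b<d. ((\<Sum>j<r. h a b j * e j) / real r)\<^sup>2) \<le> (2 * \<gamma>)\<^sup>2 * (F / c)\<^sup>2"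
  proof -
    have "((\<Sum>j<r. h a b j * e j) / real r)\<^sup>2 \<le> (\<Sum>j<r. (2 * \<gamma>)\<^sup>2 * (h a b j)\<^sup>2) / real r" for a b
    proof -
      \<comment> \<open>Cauchy-Schwarz against the constant 1 bounds the square of an average by the
        average of the squares.\<close>
      have "(\<Sum>j<r. 1 * (h a b j * e j))\<^sup>2 \<le> (\<Sum>j<r. 1\<^sup>2) * (\<Sum>j<r. (h a b j * e j)\<^sup>2)"
        by (rule Cauchy_Schwarz_ineq_sum)
      also have "\<dots> \<le> real r * (\<Sum>j<r. (2 * \<gamma>)\<^sup>2 * (h a b j)\<^sup>2)"
      proof -
        have "(h a b j * e j)\<^sup>2 \<le> (2 * \<gamma>)\<^sup>2 * (h a b j)\<^sup>2" if "j < r" for j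
        proof -
          have "(e j)\<^sup>2 \<le> (2 * \<gamma>)\<^sup>2" using q(2)[OF that] by (metis abs_ge_zero power2_abs power_mono)
          from mult_right_mono[OF this zero_le_power2[of "h a b j"]]
          show ?thesis by (simp add: power_mult_distrib mult_ac)
        qed
        then have "(\<Sum>j<r. (h a b j * e j)\<^sup>2) \<le> (\<Sum>j<r. (2 * \<gamma>)\<^sup>2 * (h a b j)\<^sup>2)"
          by (intro sum_mono) auto
        from mult_left_mono[OF this, of "real r"] show ?thesis by simp
      qed
      finally show ?thesis using r by (simp add: power_divide power2_eq_square field_simps)
    qed
    then have "(\<Sum>a<d. \<Sum>b<d. ((\<Sum>j<r. h a b j * e j) / real r)\<^sup>2)
        \<le> (\<Sum>a<d. \<Sum>b<d. (\<Sum>j<r. (2 * \<gamma>)\<^sup>2 * (h a b j)\<^sup>2) / real r)"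
      by (intro sum_mono)
    also have "\<dots> = (\<Sum>a<d. \<Sum>b<d. \<Sum>j<r. (h a b j)\<^sup>2) * ((2 * \<gamma>)\<^sup>2 / real r)"
      by (simp add: sum_distrib_left sum_distrib_right sum_divide_distrib mult.commute)
    also have "(\<Sum>a<d. \<Sum>b<d. \<Sum>j<r. (h a b j)\<^sup>2) = (\<Sum>a<d. \<Sum>j<r. \<Sum>b<d. (h a b j)\<^sup>2)"
      by (rule sum.cong[OF refl], rule sum.swap)
    also have "\<dots> = (\<Sum>j<r. \<Sum>a<d. \<Sum>b<d. (h a b j)\<^sup>2)" by (rule sum.swap)
    also have "\<dots> * ((2 * \<gamma>)\<^sup>2 / real r) \<le> (\<Sum>j<r. (F / c)\<^sup>2) * ((2 * \<gamma>)\<^sup>2 / real r)"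
      using row_le by (intro mult_right_mono sum_mono) auto
    also have "\<dots> = (2 * \<gamma>)\<^sup>2 * (F / c)\<^sup>2" using r by simp
    finally show ?thesis .
  qed
  have "gram_dist_sq d A ?B
      = (\<Sum>a<d. \<Sum>b<d. (((\<Sum>j<r. h a b j) / real r - S a b) + (\<Sum>j<r. h a b j * e j) / real r)\<^sup>2)"
    unfolding gram_dist_sq_def
  proof (intro sum.cong refl)
    fix a b assume "a \<in> {..<d}" "b \<in> {..<d}"
    then show "((\<Sum>i<dim_row A. A $$ (i, a) * A $$ (i, b)) - (\<Sum>i<dim_row ?B. ?B $$ (i, a) * ?B $$ (i, b)))\<^sup>2
      = (((\<Sum>j<r. h a b j) / real r - S a b) + (\<Sum>j<r. h a b j * e j) / real r)\<^sup>2"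
      using B[of a b] A by (subst power2_commute) (simp add: S_def algebra_simps)
  qed
  \<comment> \<open>(x + y)^2 <= 2 x^2 + 2 y^2 separates sampling error from reporting error; the
    constant 8 is 2 times the square of 2.\<close>
  also have "\<dots> \<le> (\<Sum>a<d. \<Sum>b<d. 2 * ((\<Sum>j<r. h a b j) / real r - S a b)\<^sup>2
      + 2 * ((\<Sum>j<r. h a b j * e j) / real r)\<^sup>2)"
  proof (intro sum_mono)
    fix a b
    show "(((\<Sum>j<r. h a b j) / real r - S a b) + (\<Sum>j<r. h a b j * e j) / real r)\<^sup>2
      \<le> 2 * ((\<Sum>j<r. h a b j) / real r - S a b)\<^sup>2 + 2 * ((\<Sum>j<r. h a b j * e j) / real r)\<^sup>2"
      using sum_squares_bound[of "(\<Sum>j<r. h a b j) / real r - S a b" "(\<Sum>j<r. h a b j * e j) / real r"]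
      by (simp add: power2_sum)
  qed
  also have "\<dots> = 2 * (\<Sum>a<d. \<Sum>b<d. ((\<Sum>j<r. h a b j) / real r - S a b)\<^sup>2)
      + 2 * (\<Sum>a<d. \<Sum>b<d. ((\<Sum>j<r. h a b j * e j) / real r)\<^sup>2)"
    by (simp only: sum.distrib sum_distrib_left)
  also have "\<dots> \<le> 2 * (\<Sum>a<d. \<Sum>b<d. ((\<Sum>j<r. h a b j) / real r - S a b)\<^sup>2) + 2 * ((2 * \<gamma>)\<^sup>2 * (F / c)\<^sup>2)"
    using err by (intro add_left_mono mult_left_mono) auto
  finally show ?thesis by (simp add: h_def S_def power_mult_distrib)
qed

text \<open>Markov's inequality for the total square error \<open>T\<close>, intersected with the
  almost sure guarantees of all \<open>r\<close> runs. The result is a single measurable event on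
  which the remaining argument is deterministic.\<close>

lemma sampling_phase_gram_concentration:
  assumes A: "A \<in> carrier_mat n d" and nz: "0 < frobenius_norm A" and c: "0 < c" and r: "0 < r"
    and D: "sampler c \<gamma> A D" and M: "sampling_phase s r D M"
  defines "F \<equiv> (frobenius_norm A)\<^sup>2"
  shows "\<exists>E\<in>sets M. measure M E \<ge> 1/2 \<and> (\<forall>\<omega>\<in>E.
    (\<forall>j<r. run_index \<omega> j < n \<and> 0 < row_prob D (run_index \<omega> j) \<and>
      (1 - \<gamma>) * row_prob D (run_index \<omega> j) \<le> run_estimate \<omega> j \<and>
      run_estimate \<omega> j \<le> (1 + \<gamma>) * row_prob D (run_index \<omega> j)) \<and>
    (\<Sum>a<d. \<Sum>b<d. ((\<Sum>j<r. A $$ (run_index \<omega> j, a) * A $$ (run_index \<omega> j, b) / row_prob D (run_index \<omega> j)) / real r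
        - (\<Sum>i<n. A $$ (i, a) * A $$ (i, b)))\<^sup>2) \<le> 2 * F\<^sup>2 / (c * real r))"
proof -
  interpret prob_space M using M by (simp add: sampling_phase_def)
  let ?N = "count_space UNIV \<Otimes>\<^sub>M borel :: (nat \<times> real) measure"
  define Q where "Q = row_prob D"
  define X where "X j \<omega> = (run_index \<omega> j, run_estimate \<omega> j)" for j \<omega>
  have indep: "indep_vars (\<lambda>_. ?N) X {..<r}" and distr: "\<And>j. j < r \<Longrightarrow> distr M ?N (X j) = D"
    using M by (simp_all add: sampling_phase_def X_def[abs_def])
  have X [measurable]: "X j \<in> M \<rightarrow>\<^sub>M ?N" if "j < r" for j
    using indep that by (auto simp: indep_vars_def)
  have idx [measurable]: "(\<lambda>\<omega>. run_index \<omega> j) \<in> M \<rightarrow>\<^sub>M count_space UNIV" if "j < r" for j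
    using measurable_compose[OF X[OF that] measurable_fst] by (simp add: X_def)
  have est [measurable]: "(\<lambda>\<omega>. run_estimate \<omega> j) \<in> borel_measurable M" if "j < r" for j
    using measurable_compose[OF X[OF that] measurable_snd] by (simp add: X_def)
  have F: "0 < F" using nz by (simp add: F_def)
  have row: "c * (\<Sum>j<d. (A $$ (i, j))\<^sup>2) \<le> Q i * F" if "i < n" for i
    using sampler_simps(6)[OF D, of i] A that by (simp add: Q_def F_def)
  \<comment> \<open>Since c > 0, a row that is never sampled vanishes. Division by zero yields 0 in
    \<open>h\<close>, so the estimator stays unbiased at such rows.\<close>
  have zero: "A $$ (i, a) = 0" if "i < n" "Q i = 0" "a < d" for i a
  proof -
    have "(\<Sum>j<d. (A $$ (i, j))\<^sup>2) \<le> 0" using row[OF that(1)] that(2) c by (simp add: mult_le_0_iff)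
    then have "(\<Sum>j<d. (A $$ (i, j))\<^sup>2) = 0" by (intro antisym) (auto simp: sum_nonneg)
    then show ?thesis using that(3) by (subst (asm) sum_nonneg_eq_0_iff) auto
  qed
  have Qnn: "0 \<le> Q i" for i using sampler_simps(5)[OF D] by (simp add: Q_def)
  define h where "h a b i = (if i < n then A $$ (i, a) * A $$ (i, b) / Q i else 0)" for a b i
  define S where "S a b = (\<Sum>i<n. A $$ (i, a) * A $$ (i, b))" for a b
  define v where "v a b = (\<Sum>i<n. Q i * (h a b i)\<^sup>2)" for a b
  define T where "T \<omega> = (\<Sum>a<d. \<Sum>b<d. ((\<Sum>j<r. h a b (run_index \<omega> j)) / real r - S a b)\<^sup>2)" for \<omega>
  have dimA: "dim_row A = n" using A by simp
  \<comment> \<open>Expectations over the phase are pulled back to one sampler run through the law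
    \<open>D\<close> of run \<open>j\<close>.\<close>
  have transfer: "integrable M (\<lambda>\<omega>. g (run_index \<omega> j))"
      "expectation (\<lambda>\<omega>. g (run_index \<omega> j)) = (\<Sum>i<n. Q i * g i)"
    if j: "j < r" and g: "\<And>i. n \<le> i \<Longrightarrow> g i = 0" for g :: "nat \<Rightarrow> real" and j
  proof -
    have gm: "(\<lambda>x. g (fst x)) \<in> borel_measurable ?N" by measurable
    have "integrable (distr M ?N (X j)) (\<lambda>x. g (fst x))"
      unfolding distr[OF j] using sampler_integral_row(1)[OF D, of g] g dimA by simp
    then show "integrable M (\<lambda>\<omega>. g (run_index \<omega> j))"
      by (subst (asm) integrable_distr_eq[OF X[OF j] gm]) (simp add: X_def)
    have "(\<integral>x. g (fst x) \<partial>distr M ?N (X j)) = (\<Sum>i<n. Q i * g i)"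
      unfolding distr[OF j] using sampler_integral_row(2)[OF D, of g] g dimA by (simp add: Q_def)
    then show "expectation (\<lambda>\<omega>. g (run_index \<omega> j)) = (\<Sum>i<n. Q i * g i)"
      by (subst (asm) integral_distr[OF X[OF j] gm]) (simp add: X_def)
  qed
  have h_zero: "h a b i = 0" if "n \<le> i" for a b i using that by (simp add: h_def)
  have h_mean: "(\<Sum>i<n. Q i * h a b i) = S a b" if "a < d" for a b
    unfolding S_def using that zero by (intro sum.cong) (auto simp: h_def)
  have mse: "integrable M (\<lambda>\<omega>. ((\<Sum>j<r. h a b (run_index \<omega> j)) / real r - S a b)\<^sup>2) \<and>
      expectation (\<lambda>\<omega>. ((\<Sum>j<r. h a b (run_index \<omega> j)) / real r - S a b)\<^sup>2) \<le> v a b / real r"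
    if "a < d" for a b
  proof -
    have ind: "indep_vars (\<lambda>_. borel) (\<lambda>j \<omega>. h a b (run_index \<omega> j)) {..<r}"
      using indep_vars_compose2[OF indep, of "\<lambda>_ x. h a b (fst x)" "\<lambda>_. borel"] by (simp add: X_def)
    have "integrable M (\<lambda>\<omega>. (h a b (run_index \<omega> j))\<^sup>2)"
      "expectation (\<lambda>\<omega>. (h a b (run_index \<omega> j))\<^sup>2) = v a b"
      "expectation (\<lambda>\<omega>. h a b (run_index \<omega> j)) = S a b" if "j < r" for j
      using transfer[OF that, of "\<lambda>i. (h a b i)\<^sup>2"] transfer(2)[OF that, of "h a b"]
        h_zero h_mean[OF \<open>a < d\<close>] by (simp_all add: v_def)
    then show ?thesis by (intro conjI iid_mean_square_error[OF ind r]) auto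
  qed
  have Ti: "integrable M T" unfolding T_def[abs_def] using mse by (intro Bochner_Integration.integrable_sum) auto
  have "expectation T = (\<Sum>a<d. expectation (\<lambda>\<omega>. \<Sum>b<d. ((\<Sum>j<r. h a b (run_index \<omega> j)) / real r - S a b)\<^sup>2))"
    unfolding T_def[abs_def] using mse
    by (intro Bochner_Integration.integral_sum Bochner_Integration.integrable_sum) auto
  also have "\<dots> = (\<Sum>a<d. \<Sum>b<d. expectation (\<lambda>\<omega>. ((\<Sum>j<r. h a b (run_index \<omega> j)) / real r - S a b)\<^sup>2))"
    using mse by (intro sum.cong refl Bochner_Integration.integral_sum) auto
  also have "\<dots> \<le> (\<Sum>a<d. \<Sum>b<d. v a b / real r)" using mse by (intro sum_mono) auto
  also have "\<dots> = (\<Sum>a<d. \<Sum>b<d. v a b) / real r" by (simp add: sum_divide_distrib)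
  also have "\<dots> \<le> (F\<^sup>2 / c) / real r"
  proof (rule divide_right_mono)
    have "(\<Sum>a<d. \<Sum>b<d. v a b) = (\<Sum>a<d. \<Sum>i<n. \<Sum>b<d. Q i * (h a b i)\<^sup>2)"
      unfolding v_def by (rule sum.cong[OF refl], rule sum.swap)
    also have "\<dots> = (\<Sum>i<n. \<Sum>a<d. \<Sum>b<d. Q i * (h a b i)\<^sup>2)" by (rule sum.swap)
    also have "\<dots> \<le> (\<Sum>i<n. (\<Sum>a<d. (A $$ (i, a))\<^sup>2) * (F / c))"
    proof (rule sum_mono)
      fix i assume "i \<in> {..<n}"
      then have i: "i < n" by simp
      let ?R = "\<Sum>a<d. (A $$ (i, a))\<^sup>2"
      have R: "0 \<le> ?R" by (simp add: sum_nonneg)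
      \<comment> \<open>The unreduced fraction is correct for Q i = 0 too, where both sides are
        0.\<close>
      have "(\<Sum>a<d. \<Sum>b<d. Q i * (h a b i)\<^sup>2) = Q i / (Q i)\<^sup>2 * (?R * ?R)"
      proof -
        have "(\<Sum>a<d. \<Sum>b<d. Q i * (h a b i)\<^sup>2)
            = (\<Sum>a<d. \<Sum>b<d. Q i / (Q i)\<^sup>2 * ((A $$ (i, a))\<^sup>2 * (A $$ (i, b))\<^sup>2))"
          using i by (simp add: h_def power_divide power_mult_distrib)
        also have "\<dots> = Q i / (Q i)\<^sup>2 * (\<Sum>a<d. \<Sum>b<d. (A $$ (i, a))\<^sup>2 * (A $$ (i, b))\<^sup>2)"
          by (simp only: sum_distrib_left)
        finally show ?thesis by (simp only: sum_product)
      qed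
      also have "\<dots> = ?R * (?R / Q i)" by (cases "Q i = 0") (auto simp: power2_eq_square)
      also have "\<dots> \<le> ?R * (F / c)"
      proof (cases "Q i = 0")
        case True
        then show ?thesis using R F c by simp
      next
        case False
        then have "0 < Q i" using Qnn[of i] by simp
        then have "?R / Q i \<le> F / c" using row[OF i] c by (simp add: field_simps)
        then show ?thesis using R by (rule mult_left_mono)
      qed
      finally show "(\<Sum>a<d. \<Sum>b<d. Q i * (h a b i)\<^sup>2) \<le> ?R * (F / c)" .
    qed
    also have "\<dots> = F * (F / c)"
    proof -
      have "F = (\<Sum>i<n. \<Sum>a<d. (A $$ (i, a))\<^sup>2)"
        using A by (simp add: F_def frobenius_norm_def sum_nonneg)
      then show ?thesis by (simp only: sum_distrib_right)
    qed
    finally show "(\<Sum>a<d. \<Sum>b<d. v a b) \<le> F\<^sup>2 / c" by (simp add: power2_eq_square)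
  qed simp
  finally have ET: "expectation T \<le> F\<^sup>2 / (c * real r)" by simp
  \<comment> \<open>Twice the bound on the expectation, so Markov leaves probability at most 1/2 for
    failure.\<close>
  define C where "C = 2 * F\<^sup>2 / (c * real r)"
  have C: "0 < C" using F c r by (simp add: C_def)
  have T_nn: "0 \<le> T \<omega>" for \<omega> by (simp add: T_def sum_nonneg)
  have Tm [measurable]: "T \<in> borel_measurable M" using Ti by simp
  have "prob {\<omega>\<in>space M. T \<omega> \<ge> C} \<le> expectation T / C"
    using integral_Markov_inequality_measure[OF Ti sets.empty_sets _ C] T_nn by simp
  also have "\<dots> \<le> (C / 2) / C" using ET C by (intro divide_right_mono) (auto simp: C_def)
  finally have half: "prob {\<omega>\<in>space M. T \<omega> \<ge> C} \<le> 1/2" using C by simp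
  define good where "good j \<omega> \<longleftrightarrow> run_index \<omega> j < n \<and> 0 < Q (run_index \<omega> j) \<and>
      (1 - \<gamma>) * Q (run_index \<omega> j) \<le> run_estimate \<omega> j \<and>
      run_estimate \<omega> j \<le> (1 + \<gamma>) * Q (run_index \<omega> j)" for j \<omega>
  have good_AE: "AE \<omega> in M. good j \<omega>" if "j < r" for j
    using AE_distrD[OF X[OF that], unfolded distr[OF that], OF sampler_AE[OF D]]
    by (simp add: good_def X_def Q_def dimA)
  have good_m: "{\<omega>\<in>space M. good j \<omega>} \<in> sets M" if "j < r" for j
  proof -
    have Qm [measurable]: "(\<lambda>\<omega>. Q (run_index \<omega> j)) \<in> borel_measurable M"
      by (rule measurable_compose[OF idx[OF that]]) simp
    have [measurable]: "(\<lambda>\<omega>. run_estimate \<omega> j) \<in> borel_measurable M"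
      "(\<lambda>\<omega>. run_index \<omega> j) \<in> M \<rightarrow>\<^sub>M count_space UNIV" using est idx that by auto
    show ?thesis unfolding good_def by measurable
  qed
  define E where "E = {\<omega>\<in>space M. (\<forall>j\<in>{..<r}. good j \<omega>) \<and> T \<omega> < C}"
  have G: "{\<omega>\<in>space M. \<forall>j\<in>{..<r}. good j \<omega>} \<in> sets M"
    using good_m by (intro sets.sets_Collect_finite_All) auto
  have E: "E \<in> sets M"
    unfolding E_def by (intro sets.sets_Collect_conj G) measurable
  have "AE \<omega> in M. \<forall>j\<in>{..<r}. good j \<omega>" using good_AE by (intro AE_finite_allI) auto
  then have "prob E = prob {\<omega>\<in>space M. T \<omega> < C}"
    using E by (intro measure_eq_AE) (auto simp: E_def)
  also have "{\<omega>\<in>space M. T \<omega> < C} = space M - {\<omega>\<in>space M. T \<omega> \<ge> C}" by auto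
  also have "prob \<dots> = 1 - prob {\<omega>\<in>space M. T \<omega> \<ge> C}" by (rule prob_compl) measurable
  finally have "1/2 \<le> prob E" using half by simp
  moreover have "(\<forall>j<r. good j \<omega>) \<and> (\<Sum>a<d. \<Sum>b<d. ((\<Sum>j<r. A $$ (run_index \<omega> j, a) * A $$ (run_index \<omega> j, b)
      / Q (run_index \<omega> j)) / real r - S a b)\<^sup>2) \<le> C" if "\<omega> \<in> E" for \<omega>
  proof -
    have g: "\<forall>j<r. good j \<omega>" and "T \<omega> < C" using that by (auto simp: E_def)
    moreover have "(\<Sum>j<r. h a b (run_index \<omega> j))
        = (\<Sum>j<r. A $$ (run_index \<omega> j, a) * A $$ (run_index \<omega> j, b) / Q (run_index \<omega> j))" for a b
      using g by (intro sum.cong) (auto simp: h_def good_def)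
    ultimately show ?thesis by (simp add: T_def)
  qed
  ultimately show ?thesis using E unfolding good_def Q_def S_def C_def by blast
qed

subsection \<open>The protocol\<close>

lemma words_append: "words (xs @ ys) = words xs + words ys"
  by (simp add: words_def)

lemma words_concat: "words (concat mss) = (\<Sum>ms\<leftarrow>mss. words ms)"
  by (induction mss) (simp_all add: words_append, simp add: words_def)

text \<open>Each pair of a run and a server costs one word for the index and \<open>d\<close> words
  for the row.\<close>

lemma words_row_messages:
  assumes "\<forall>t\<in>{1..s}. As t \<in> carrier_mat n d"
  shows "words (row_messages s As r \<omega>) = r * (s * Suc d)"
proof -
  have pair: "words [Message 1 t [Index (run_index \<omega> j)],
      Message t 1 (map Scalar (list_of_vec (row (As t) (run_index \<omega> j))))] = Suc d"
    if "t \<in> set [1..<Suc s]" for t j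
  proof -
    have "As t \<in> carrier_mat n d" using assms that by auto
    then show ?thesis by (simp add: words_def)
  qed
  have "words (concat (map (\<lambda>t. [Message 1 t [Index (run_index \<omega> j)],
      Message t 1 (map Scalar (list_of_vec (row (As t) (run_index \<omega> j))))]) [1..<Suc s])) = s * Suc d" for j
  proof -
    have "(\<Sum>t\<leftarrow>[1..<Suc s]. words [Message 1 t [Index (run_index \<omega> j)],
        Message t 1 (map Scalar (list_of_vec (row (As t) (run_index \<omega> j))))])
      = (\<Sum>t\<leftarrow>[1..<Suc s]. Suc d)"
      by (rule arg_cong[where f = sum_list], rule map_cong[OF refl], rule pair)
    then show ?thesis by (simp add: words_concat comp_def sum_list_triv del: upt_Suc)
  qed
  then show ?thesis by (simp add: row_messages_def words_concat comp_def sum_list_triv)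
qed

text \<open>The constant 4 is the product of d + 1 <= 2 d and the factor 2 in the upper bound on
  \<open>r\<close>.\<close>

lemma protocol_words_le:
  fixes \<epsilon> :: real
  assumes "1 \<le> d" "\<forall>t\<in>{1..s}. As t \<in> carrier_mat n d" and r: "real r \<le> 2 * (real k)\<^sup>2 / \<epsilon>\<^sup>2" and C: "4 \<le> C"
  shows "real (words (protocol_messages s As r \<omega>))
    \<le> C * real s * (real k)\<^sup>2 * real d / \<epsilon>\<^sup>2 + real (words (sampling_messages \<omega>))"
proof -
  have "real (r * (s * Suc d)) \<le> real r * (real s * (2 * real d))"
    unfolding of_nat_mult using assms(1) by (intro mult_left_mono) auto
  also have "\<dots> \<le> (2 * (real k)\<^sup>2 / \<epsilon>\<^sup>2) * (real s * (2 * real d))"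
    using r by (intro mult_right_mono) auto
  also have "\<dots> = 4 * (real s * (real k)\<^sup>2 * real d / \<epsilon>\<^sup>2)" by (simp add: field_simps)
  also have "\<dots> \<le> C * (real s * (real k)\<^sup>2 * real d / \<epsilon>\<^sup>2)"
    using C by (intro mult_right_mono) auto
  finally show ?thesis
    by (simp add: protocol_messages_def words_append words_row_messages[OF assms(2)] mult_ac)
qed

text \<open>The index bound ensures that aggregating the local rows gives an actual row of
  \<open>A\<close>.\<close>

lemma sampled_matrix_global:
  assumes As: "\<forall>t\<in>{1..s}. As t \<in> carrier_mat n d" and A: "A = global_matrix f s As n d"
    and idx: "\<And>j. j < r \<Longrightarrow> run_index \<omega> j < n"
  shows "sampled_matrix f s As d r \<omega>
    = mat r d (\<lambda>(j, l). A $$ (run_index \<omega> j, l) / sqrt (real r * run_estimate \<omega> j))"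
proof -
  have "row (As t) i $ l = As t $$ (i, l)" if "t \<in> {1..s}" "i < n" "l < d" for t i l
  proof -
    have "As t \<in> carrier_mat n d" using As that(1) by blast
    then show ?thesis using that(2,3) by auto
  qed
  then show ?thesis
    using idx by (auto intro!: eq_matI simp: sampled_matrix_def aggregated_row_def A global_matrix_def)
qed

lemma frobenius_norm_pos:
  assumes "A \<in> carrier_mat n d" "A \<noteq> 0\<^sub>m n d"
  shows "0 < frobenius_norm A"
proof (rule ccontr)
  assume "\<not> 0 < frobenius_norm A"
  then have "(\<Sum>i<n. \<Sum>j<d. (A $$ (i, j))\<^sup>2) = 0"
    using assms(1) by (simp add: frobenius_norm_def sum_nonneg antisym)
  then have "A $$ (i, j) = 0" if "i < n" "j < d" for i j
    using that by (auto simp: sum_nonneg_eq_0_iff sum_nonneg)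
  then have "A = 0\<^sub>m n d" using assms(1) by (intro eq_matI) auto
  with assms(2) show False by simp
qed

text \<open>The event is fixed before the output, so the bound holds at once for every choice of top
  singular vectors.\<close>

lemma protocol_error:
  fixes c \<epsilon> \<gamma> :: real
  assumes c: "0 < c" "c \<le> 1" and As: "\<forall>t\<in>{1..s}. As t \<in> carrier_mat n d"
    and A_eq: "A = global_matrix f s As n d" and nz: "A \<noteq> 0\<^sub>m n d"
    and k: "k \<in> {1..d}" and \<epsilon>: "0 < \<epsilon>" and r: "1 \<le> r" "(real k)\<^sup>2 / \<epsilon>\<^sup>2 \<le> real r"
    and \<gamma>: "0 \<le> \<gamma>" "\<gamma> \<le> 1/2 / sqrt (real r)"
    and D: "sampler c \<gamma> A D" and M: "sampling_phase s r D M"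
  shows "\<exists>E\<in>sets M. measure M E \<ge> 1/2 \<and>
    (\<forall>\<omega>\<in>E. (\<exists>P. protocol_output f s As d k r \<omega> P) \<and>
      (\<forall>P. protocol_output f s As d k r \<omega> P \<longrightarrow>
        projection_matrix d P \<and> mat_rank P = k \<and>
        (\<forall>Ak. best_rank_approx k A Ak \<longrightarrow>
          (frobenius_norm (A - A * P))\<^sup>2
            \<le> (frobenius_norm (A - Ak))\<^sup>2 + (4 + 6 / c) * \<epsilon> * (frobenius_norm A)\<^sup>2)))"
proof -
  have A: "A \<in> carrier_mat n d" by (simp add: A_eq global_matrix_def)
  have k1: "1 \<le> k" "k \<le> d" and r0: "0 < r" using k r by auto
  define F where "F = (frobenius_norm A)\<^sup>2"
  obtain E where E: "E \<in> sets M" "measure M E \<ge> 1/2" and good: "\<And>\<omega>. \<omega> \<in> E \<Longrightarrow>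
    (\<forall>j<r. run_index \<omega> j < n \<and> 0 < row_prob D (run_index \<omega> j) \<and>
      (1 - \<gamma>) * row_prob D (run_index \<omega> j) \<le> run_estimate \<omega> j \<and>
      run_estimate \<omega> j \<le> (1 + \<gamma>) * row_prob D (run_index \<omega> j)) \<and>
    (\<Sum>a<d. \<Sum>b<d. ((\<Sum>j<r. A $$ (run_index \<omega> j, a) * A $$ (run_index \<omega> j, b) / row_prob D (run_index \<omega> j)) / real r
        - (\<Sum>i<n. A $$ (i, a) * A $$ (i, b)))\<^sup>2) \<le> 2 * F\<^sup>2 / (c * real r)"
    using sampling_phase_gram_concentration[OF A frobenius_norm_pos[OF A nz] c(1) r0 D M]
    unfolding F_def by blast
  have sq: "1 \<le> sqrt (real r)" using r by simp
  then have "1/2 / sqrt (real r) \<le> 1/2" by (simp add: field_simps)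
  with \<gamma> have \<gamma>_half: "\<gamma> \<le> 1/2" by linarith
  have "\<gamma>\<^sup>2 \<le> (1/2 / sqrt (real r))\<^sup>2" using \<gamma> by (intro power_mono)
  then have \<gamma>_sq: "8 * \<gamma>\<^sup>2 \<le> 2 / real r" by (simp add: power_divide)
  have row: "c * (\<Sum>j<d. (A $$ (i, j))\<^sup>2) \<le> row_prob D i * F" if "i < n" for i
    using sampler_simps(6)[OF D, of i] A that by (simp add: F_def)
  have "(\<exists>P. protocol_output f s As d k r \<omega> P) \<and>
      (\<forall>P. protocol_output f s As d k r \<omega> P \<longrightarrow>
        projection_matrix d P \<and> mat_rank P = k \<and>
        (\<forall>Ak. best_rank_approx k A Ak \<longrightarrow>
          (frobenius_norm (A - A * P))\<^sup>2 \<le> (frobenius_norm (A - Ak))\<^sup>2 + (4 + 6 / c) * \<epsilon> * F))"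
    if \<omega>: "\<omega> \<in> E" for \<omega>
  proof -
    define B where "B = sampled_matrix f s As d r \<omega>"
    have B: "B \<in> carrier_mat r d" by (simp add: B_def sampled_matrix_def)
    note g = good[OF \<omega>, THEN conjunct1, rule_format]
    have B_eq: "B = mat r d (\<lambda>(j, l). A $$ (run_index \<omega> j, l) / sqrt (real r * run_estimate \<omega> j))"
      unfolding B_def using g by (intro sampled_matrix_global[OF As A_eq]) blast
    have "gram_dist_sq d A B \<le> 2 * (2 * F\<^sup>2 / (c * real r)) + 8 * \<gamma>\<^sup>2 * (F / c)\<^sup>2"
      unfolding B_eq using good[OF \<omega>, THEN conjunct2]
      by (intro order_trans[OF gram_dist_sq_estimates[OF A r0 c(1) \<gamma>(1) \<gamma>_half row g]]) auto
    \<comment> \<open>As c <= 1, 1 / c may be weakened to 1 / c^2, which brings sampling and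
      reporting errors to the common form (F / c)^2 / r.\<close>
    also have "\<dots> \<le> 4 * ((F / c)\<^sup>2 / real r) + 2 / real r * (F / c)\<^sup>2"
    proof (rule add_mono)
      have "c * c \<le> c" using c by (simp add: mult_left_le)
      then have "F\<^sup>2 / c \<le> F\<^sup>2 / (c * c)" using c by (intro divide_left_mono) auto
      then have "F\<^sup>2 / c / real r \<le> F\<^sup>2 / (c * c) / real r" by (intro divide_right_mono) auto
      then show "2 * (2 * F\<^sup>2 / (c * real r)) \<le> 4 * ((F / c)\<^sup>2 / real r)"
        by (simp add: power2_eq_square)
    qed (use \<gamma>_sq in \<open>rule mult_right_mono, simp\<close>)
    also have "\<dots> = 6 * (F / c)\<^sup>2 / real r" by simp
    \<comment> \<open>Rounding 6 up to 9 makes the bound a perfect square.\<close>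
    also have "\<dots> \<le> 9 * (F / c)\<^sup>2 / real r" by (intro divide_right_mono mult_right_mono) auto
    also have "\<dots> \<le> 9 * (F / c)\<^sup>2 / ((real k)\<^sup>2 / \<epsilon>\<^sup>2)"
      using r r0 k1 \<epsilon> by (intro divide_left_mono) auto
    also have "\<dots> = (3 * F / c * \<epsilon> / real k)\<^sup>2" by (simp add: power_divide power_mult_distrib)
    finally have "sqrt (gram_dist_sq d A B) \<le> 3 * F / c * \<epsilon> / real k"
      using c \<epsilon> by (intro real_le_lsqrt) (auto simp: F_def)
    then have "2 * real k * sqrt (gram_dist_sq d A B) \<le> 2 * real k * (3 * F / c * \<epsilon> / real k)"
      by (intro mult_left_mono) auto
    also have "\<dots> = 6 / c * \<epsilon> * F" using k1 by simp
    \<comment> \<open>The error needs only 6 / c; the added 4 lets the same constant bound the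
      communication.\<close>
    also have "\<dots> \<le> (4 + 6 / c) * \<epsilon> * F"
      using \<epsilon> by (intro mult_right_mono) (auto simp: F_def)
    finally have err: "2 * real k * sqrt (gram_dist_sq d A B) \<le> (4 + 6 / c) * \<epsilon> * F" .
    obtain U \<sigma> V where "is_svd B U \<sigma> V" using svd_exists[OF B] by blast
    then have "\<exists>W. top_right_singular_vectors k B W"
      unfolding top_right_singular_vectors_def by blast
    then have "\<exists>P. protocol_output f s As d k r \<omega> P" unfolding protocol_output_def B_def by blast
    moreover have "projection_matrix d P \<and> mat_rank P = k \<and>
        (\<forall>Ak. best_rank_approx k A Ak \<longrightarrow>
          (frobenius_norm (A - A * P))\<^sup>2 \<le> (frobenius_norm (A - Ak))\<^sup>2 + (4 + 6 / c) * \<epsilon> * F)"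
      if out: "protocol_output f s As d k r \<omega> P" for P
    proof -
      obtain W where W: "top_right_singular_vectors k B W" and P: "P = W * transpose_mat W"
        using out unfolding protocol_output_def B_def by blast
      have Wo: "orthonormal_cols d k W" by (rule top_right_singular_vectors_orthonormal[OF B W k1(2)])
      have "(frobenius_norm (A - A * P))\<^sup>2 \<le> (frobenius_norm (A - Ak))\<^sup>2 + (4 + 6 / c) * \<epsilon> * F"
        if "best_rank_approx k A Ak" for Ak
      proof -
        have "Ak \<in> carrier_mat n d" "mat_rank Ak \<le> k"
          using that A by (auto simp: best_rank_approx_def)
        from sampled_projection_error[OF A B W k1 this] show ?thesis using err by (simp add: P)
      qed
      then show ?thesis
        using projection_matrix_orthonormal_cols[OF Wo] mat_rank_orthonormal_cols[OF Wo] by (simp add: P)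
    qed
    ultimately show ?thesis by blast
  qed
  then show ?thesis using E unfolding F_def by blast
qed

theorem theorem1:
  fixes c :: real
  assumes "0 < c" and "c \<le> 1"
  shows "\<exists>C1 > (0::real). \<exists>C2 > (0::real). \<exists>C3 > (0::real). \<exists>p0 > (0::real).
    \<forall>(n::nat) (d::nat) (s::nat) (f :: real \<Rightarrow> real) (As :: nat \<Rightarrow> real mat) (A :: real mat).
      n \<ge> 1 \<longrightarrow> d \<ge> 1 \<longrightarrow> s \<ge> 1 \<longrightarrow>
      (\<forall>t\<in>{1..s}. As t \<in> carrier_mat n d) \<longrightarrow>
      A = global_matrix f s As n d \<longrightarrow> A \<noteq> 0\<^sub>m n d \<longrightarrow>
      (\<forall>k\<in>{1..d}. \<forall>\<epsilon> > (0::real). \<forall>(r::nat) (\<gamma>::real)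
          (D :: (nat \<times> real) measure) (M :: outcome measure).
        r \<ge> 1 \<longrightarrow>
        C1 * (real k)\<^sup>2 / \<epsilon>\<^sup>2 \<le> real r \<longrightarrow> real r \<le> 2 * C1 * (real k)\<^sup>2 / \<epsilon>\<^sup>2 \<longrightarrow>
        0 \<le> \<gamma> \<longrightarrow> \<gamma> \<le> C2 / sqrt (real r) \<longrightarrow>
        sampler c \<gamma> A D \<longrightarrow> sampling_phase s r D M \<longrightarrow>
        (\<exists>E\<in>sets M. measure M E \<ge> p0 \<and>
          (\<forall>\<omega>\<in>E.
            (\<exists>P. protocol_output f s As d k r \<omega> P) \<and>
            (\<forall>P. protocol_output f s As d k r \<omega> P \<longrightarrow>
              projection_matrix d P \<and> mat_rank P = k \<and>
              (\<forall>Ak. best_rank_approx k A Ak \<longrightarrow>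
                (frobenius_norm (A - A * P))\<^sup>2
                  \<le> (frobenius_norm (A - Ak))\<^sup>2 + C3 * \<epsilon> * (frobenius_norm A)\<^sup>2)))) \<and>
        (\<forall>\<omega>\<in>space M.
          real (words (protocol_messages s As r \<omega>))
            \<le> C3 * real s * (real k)\<^sup>2 * real d / \<epsilon>\<^sup>2 + real (words (sampling_messages \<omega>))))"
proof -
  have C3: "0 < 4 + 6 / c" "4 \<le> 4 + 6 / c" using assms(1) by (simp_all add: add_pos_pos)
  show ?thesis
  \<comment> \<open>The witnesses are C1 = 1, C2 = 1/2, C3 = 4 + 6 / c and p0 = 1/2. The
    communication bound is proved for every outcome, not only on the good event.\<close>
  proof (rule exI[of _ 1], rule conjI, simp, rule exI[of _ "1/2"], rule conjI, simp,
      rule exI[of _ "4 + 6 / c"], rule conjI, rule C3, rule exI[of _ "1/2"], rule conjI, simp,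
      intro allI impI ballI conjI, goal_cases)
    case 1
    then show ?case by (intro protocol_error[OF assms]) simp_all
  next
    case 2
    then show ?case by (intro protocol_words_le C3) simp_all
  qed
qed

end
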